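(* There is a deterministic algorithm which, given two finite $p$-groups $G$ and $H$ of order $n$ (for some prime $p$) by their multiplication tables, decides whether $G \cong H$ in time $n^{(1/2)\log n + O(1)}$.
   Context: A $p$-group is a finite group whose order is a power of the prime $p$. Groups are given by multiplication tables and time is measured in terms of the group order $n$; $\log$ denotes the base-2 logarithm. *)

theory Defs
  imports Complex_Main "HOL-Library.Landau_Symbols" "HOL-Library.Log_Nat"
    "HOL-Computational_Algebra.Primes" "HOL-Algebra.Group" "HOL-Algebra.Coset"
begin

text \<open>
  Algorithms are programs of the deterministic random access machine under the logarithmic cost
  criterion (Cook--Reckhow; Aho--Hopcroft--Ullman).  Registers are indexed by and contain natural
  numbers; the arithmetic is addition and truncated subtraction only.  The input is a
  read-only array of natural numbers, so it does not occupy registers.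
\<close>

datatype instr =
    LoadConst nat nat    \<comment> \<open>\<open>R[i] := c\<close>\<close>
  | Add nat nat nat      \<comment> \<open>\<open>R[i] := R[j] + R[k]\<close>\<close>
  | Sub nat nat nat      \<comment> \<open>\<open>R[i] := R[j] - R[k]\<close>, truncated at 0\<close>
  | Load nat nat         \<comment> \<open>\<open>R[i] := R[R[j]]\<close>\<close>
  | Store nat nat        \<comment> \<open>\<open>R[R[i]] := R[j]\<close>\<close>
  | ReadInput nat nat    \<comment> \<open>\<open>R[i] := x[R[j]]\<close>, and 0 beyond the end of the input \<open>x\<close>\<close>
  | Jump nat
  | JumpZero nat nat     \<comment> \<open>if \<open>R[i] = 0\<close> jump to the second argument\<close>

type_synonym program = "instr list"
type_synonym memory = "nat \<Rightarrow> nat"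
type_synonym config = "nat \<times> memory" \<comment> \<open>program counter and registers\<close>

definition input_at :: "nat list \<Rightarrow> nat \<Rightarrow> nat" where
  "input_at x a = (if a < length x then x ! a else 0)"

fun exec :: "nat list \<Rightarrow> instr \<Rightarrow> config \<Rightarrow> config" where
  "exec x (LoadConst i c) (pc, R) = (pc + 1, R(i := c))"
| "exec x (Add i j k) (pc, R) = (pc + 1, R(i := R j + R k))"
| "exec x (Sub i j k) (pc, R) = (pc + 1, R(i := R j - R k))"
| "exec x (Load i j) (pc, R) = (pc + 1, R(i := R (R j)))"
| "exec x (Store i j) (pc, R) = (pc + 1, R(R i := R j))"
| "exec x (ReadInput i j) (pc, R) = (pc + 1, R(i := input_at x (R j)))"
| "exec x (Jump l) (pc, R) = (l, R)"
| "exec x (JumpZero i l) (pc, R) = ((if R i = 0 then l else pc + 1), R)"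

text \<open>Number of binary digits, with \<open>0\<close> having one digit.\<close>

definition bits :: "nat \<Rightarrow> nat" where
  "bits a = max 1 (floorlog 2 a)"

text \<open>An instruction costs the total number of digits of the addresses and operands it uses.\<close>

fun cost :: "nat list \<Rightarrow> instr \<Rightarrow> memory \<Rightarrow> nat" where
  "cost x (LoadConst i c) R = bits i + bits c"
| "cost x (Add i j k) R = bits i + bits j + bits k + bits (R j) + bits (R k)"
| "cost x (Sub i j k) R = bits i + bits j + bits k + bits (R j) + bits (R k)"
| "cost x (Load i j) R = bits i + bits j + bits (R j) + bits (R (R j))"
| "cost x (Store i j) R = bits i + bits j + bits (R i) + bits (R j)"
| "cost x (ReadInput i j) R = bits i + bits j + bits (R j) + bits (input_at x (R j))"
| "cost x (Jump l) R = 1"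
| "cost x (JumpZero i l) R = bits i + bits (R i)"

text \<open>\<open>run P x s t s'\<close>: started in \<open>s\<close>, the program halts in \<open>s'\<close> after time exactly \<open>t\<close>.
  Halting means that the program counter has left the program.\<close>

inductive run :: "program \<Rightarrow> nat list \<Rightarrow> config \<Rightarrow> nat \<Rightarrow> config \<Rightarrow> bool"
  for P :: program and x :: "nat list" where
  halt: "length P \<le> pc \<Longrightarrow> run P x (pc, R) 0 (pc, R)"
| step: "pc < length P \<Longrightarrow> run P x (exec x (P ! pc) (pc, R)) t s
    \<Longrightarrow> run P x (pc, R) (cost x (P ! pc) R + t) s"

lemma run_deterministic:
  "run P x s t s' \<Longrightarrow> run P x s u s'' \<Longrightarrow> t = u \<and> s' = s''"
proof (induction arbitrary: u s'' rule: run.induct)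
  case (halt pc R)
  from halt(2) show ?case
    by (rule run.cases) (use halt(1) in simp_all)
next
  case (step pc R t s)
  from step.prems show ?case
  proof (cases rule: run.cases)
    case halt
    with step.hyps(1) show ?thesis by simp
  next
    case (step u')
    with step.IH[OF step(3)] show ?thesis by simp
  qed
qed

text \<open>All registers are initially \<open>0\<close>; the output is the final content of register \<open>0\<close>.\<close>

definition computes_in_time :: "program \<Rightarrow> nat list \<Rightarrow> nat \<Rightarrow> nat \<Rightarrow> bool" where
  "computes_in_time P x y t \<longleftrightarrow> (\<exists>pc R. run P x (0, \<lambda>_. 0) t (pc, R) \<and> R 0 = y)"

definition p_group :: "nat \<Rightarrow> ('a, 'b) monoid_scheme \<Rightarrow> bool" where
  "p_group p G \<longleftrightarrow> prime p \<and> group G \<and> finite (carrier G) \<and> (\<exists>k. order G = p ^ k)"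

text \<open>Multiplication table, row by row, of a group with carrier \<open>{0..<n}\<close>.\<close>

definition mult_table :: "nat \<Rightarrow> nat monoid \<Rightarrow> nat list" where
  "mult_table n G = concat (map (\<lambda>i. map (\<lambda>j. i \<otimes>\<^bsub>G\<^esub> j) [0..<n]) [0..<n])"

definition iso_instance :: "nat \<Rightarrow> nat monoid \<Rightarrow> nat monoid \<Rightarrow> nat list" where
  "iso_instance n G H = n # mult_table n G @ mult_table n H"

end

theory Submission
  imports Defs "HOL-Algebra.Generated_Groups"
begin

text \<open>
  The algorithm is bidirectional collision detection (Rosenbaum).  Let \<open>h\<close> be about half of \<open>log n\<close>.  A tuple whose entries are chosen greedily outside the
  subgroup generated by the preceding ones generates the group once it has \<open>2h\<close> entries.  Fix
  such a greedy tuple \<open>a\<close> of length \<open>h\<close> in \<open>G\<close>, and consider the \<open>n\<^sup>h\<close> tuples \<open>a @ x\<close> of \<open>G\<close> with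
  arbitrary \<open>x\<close> and the \<open>n\<^sup>h\<close> tuples \<open>y @ b\<close> of \<open>H\<close> with arbitrary \<open>y\<close> and \<open>b\<close> a greedy completion of
  \<open>y\<close>.  An isomorphism \<open>\<phi>\<close> maps \<open>a\<close> to some \<open>y\<close>, and then \<open>a @ x\<close> to \<open>y @ b\<close> for
  \<open>x = \<phi>\<^sup>-\<^sup>1(b)\<close>; so it suffices to look for a pair of tuples in these two lists that have the same
  Cayley graph.  The graphs are numbered by breadth-first search and encoded as natural numbers of
  polynomial length.  Such a number is used as an address at which the tuples of \<open>H\<close> leave a mark,
  so that no sorting is needed.
\<close>

section \<open>A structured language for the random access machine\<close>

text \<open>Trying all images of a generating tuple of about log n elements costs n^(log n); meeting
  in the middle takes the square root of that. The two lists are asymmetric on purpose: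
  \<open>b\<close> depends on \<open>y\<close> alone, so H contributes only n^h tuples, while the
  arbitrary \<open>x\<close> on the side of G is bound to include the preimage of whatever
  \<open>b\<close> was chosen. Greedy entries at least double the generated subgroup, except that
  the first entry may be the unit; hence \<open>h\<close> is the least positive number with n <=
  2^(2h - 1), and minimality gives h <= (log n)/2 + 3/2. Conversely, a collision proves isomorphism
  because only generating tuples of H leave marks and the code determines the labelled Cayley graph.
  All work besides the n^h rounds is polynomial. Under the logarithmic cost this includes memory
  access: the addresses are huge, but have only O(n^2 h) binary digits. Memory is zero at the start,
  so the marks need no initialisation. Programs are verified at a level that counts commands and
  keeps all values below a bound \<open>M\<close>; one simulation theorem turns this into machine
  time.\<close>

text \<open>\<open>vRes\<close> is the output, \<open>vH\<close> and \<open>vM\<close> hold \<open>h\<close> and \<open>2h\<close>, \<open>vK\<close> the length of the tuple under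
  consideration, \<open>vOff\<close> the position of its multiplication table in the input.  The tuples of \<open>G\<close> and \<open>H\<close>
  are in \<open>aGA\<close> and \<open>aGB\<close>; \<open>aDic\<close> contains the marks.\<close>

datatype var = vRes | vZero | vOne | vN | vH | vM | vOff | vK | vPos | vI | vLen | vCode
  | vU | vW | vV | vT | vF | vJ | vLo | vHi | vQ

datatype arr = aGA | aGB | aLst | aIdx | aDic

text \<open>Tests have the form \<open>v < w\<close> because the truncated difference
  \<open>w - v\<close> is nonzero exactly in this case, so that one \<open>Sub\<close> and one
  \<open>JumpZero\<close> implement them.\<close>

datatype com =
    Const var nat
  | Plus var var var
  | Minus var var var
  | Read var arr var
  | Write arr var var
  | Input var var
  | Seq com com (infixr \<open>;;\<close> 60)
  | IfLess var var com com
  | WhileLess var var com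

type_synonym vars = "var \<Rightarrow> nat"
type_synonym arrs = "arr \<Rightarrow> nat \<Rightarrow> nat"

section \<open>Memory layout and translation to machine code\<close>

primrec var_id :: "var \<Rightarrow> nat" where
  "var_id vRes = 0" | "var_id vZero = 1" | "var_id vOne = 2" | "var_id vN = 3" | "var_id vH = 4"
| "var_id vM = 5" | "var_id vOff = 6" | "var_id vK = 7" | "var_id vPos = 8" | "var_id vI = 9"
| "var_id vLen = 10" | "var_id vCode = 11" | "var_id vU = 12" | "var_id vW = 13" | "var_id vV = 14"
| "var_id vT = 15" | "var_id vF = 16" | "var_id vJ = 17" | "var_id vLo = 18" | "var_id vHi = 19"
| "var_id vQ = 20"

primrec arr_id :: "arr \<Rightarrow> nat" where
  "arr_id aGA = 1" | "arr_id aGB = 2" | "arr_id aLst = 3" | "arr_id aIdx = 4" | "arr_id aDic = 5"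

lemma var_id_inj: "var_id v = var_id w \<Longrightarrow> v = w"
  by (cases v; cases w; simp)

lemma arr_id_inj: "arr_id a = arr_id b \<Longrightarrow> a = b"
  by (cases a; cases b; simp)

lemma var_id_le: "var_id v \<le> 20"
  by (cases v) simp_all

lemma arr_id_bounds: "1 \<le> arr_id a" "arr_id a \<le> 5"
  by (cases a; simp)+

text \<open>Residues modulo 8 separate the address space: 0 for variables, 1 to 5 for the (unbounded)
  arrays, 7 for the two scratch registers 7 and 15.\<close>

definition reg :: "var \<Rightarrow> nat" where
  "reg v = 8 * var_id v"

definition cell :: "arr \<Rightarrow> nat \<Rightarrow> nat" where
  "cell a i = 8 * i + arr_id a"

lemma reg_eq_iff [simp]: "reg v = reg w \<longleftrightarrow> v = w"
  by (auto simp: reg_def dest: var_id_inj)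

lemma cell_mod: "cell a i mod 8 = arr_id a" and cell_div: "cell a i div 8 = i"
  using arr_id_bounds[of a] by (simp_all add: cell_def)

lemma cell_eq_iff [simp]: "cell a i = cell b j \<longleftrightarrow> a = b \<and> i = j"
  by (metis arr_id_inj cell_div cell_mod)

lemma reg_neq_cell [simp]: "reg v \<noteq> cell a i" "cell a i \<noteq> reg v"
proof -
  have "reg v mod 8 = 0" by (simp add: reg_def)
  then show "reg v \<noteq> cell a i" "cell a i \<noteq> reg v"
    using cell_mod[of a i] arr_id_bounds[of a] by auto
qed

lemma scratch_neq [simp]:
  "reg v \<noteq> 7" "reg v \<noteq> 15" "cell a i \<noteq> 7" "cell a i \<noteq> 15"
  "7 \<noteq> reg v" "15 \<noteq> reg v" "7 \<noteq> cell a i" "15 \<noteq> cell a i"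
proof -
  have "reg v mod 8 = 0" by (simp add: reg_def)
  then show "reg v \<noteq> 7" "reg v \<noteq> 15" "7 \<noteq> reg v" "15 \<noteq> reg v" by auto
  show "cell a i \<noteq> 7" "cell a i \<noteq> 15" "7 \<noteq> cell a i" "15 \<noteq> cell a i"
    using cell_mod[of a i] arr_id_bounds[of a] by auto
qed

text \<open>The machine only adds: three doublings compute \<open>8 * i\<close> in register 7, and
  register 15 supplies the residue of the array.\<close>

definition address :: "arr \<Rightarrow> var \<Rightarrow> instr list" where
  "address a i = [Add 7 (reg i) (reg i), Add 7 7 7, Add 7 7 7, LoadConst 15 (arr_id a), Add 7 7 15]"

lemma length_address [simp]: "length (address a i) = 5"
  by (simp add: address_def)

fun size_of :: "com \<Rightarrow> nat" where
  "size_of (Read v a i) = 6"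
| "size_of (Write a i v) = 6"
| "size_of (c ;; d) = size_of c + size_of d"
| "size_of (IfLess v w c d) = size_of c + size_of d + 3"
| "size_of (WhileLess v w c) = size_of c + 3"
| "size_of _ = 1"

text \<open>Jump targets are absolute. Hence the parameter \<open>l\<close>, the position of the
  first instruction, and the separate function \<open>size_of\<close>, from which the targets are
  computed.\<close>

fun compile :: "nat \<Rightarrow> com \<Rightarrow> program" where
  "compile l (Const v c) = [LoadConst (reg v) c]"
| "compile l (Plus v u w) = [Add (reg v) (reg u) (reg w)]"
| "compile l (Minus v u w) = [Sub (reg v) (reg u) (reg w)]"
| "compile l (Read v a i) = address a i @ [Load (reg v) 7]"
| "compile l (Write a i v) = address a i @ [Store 7 (reg v)]"
| "compile l (Input v i) = [ReadInput (reg v) (reg i)]"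
| "compile l (c ;; d) = compile l c @ compile (l + size_of c) d"
| "compile l (IfLess v w c d) = [Sub 7 (reg w) (reg v), JumpZero 7 (l + size_of c + 3)]
     @ compile (l + 2) c @ [Jump (l + size_of c + size_of d + 3)] @ compile (l + size_of c + 3) d"
| "compile l (WhileLess v w c) = [Sub 7 (reg w) (reg v), JumpZero 7 (l + size_of c + 3)]
     @ compile (l + 2) c @ [Jump l]"

lemma length_compile [simp]: "length (compile l c) = size_of c"
  by (induction c arbitrary: l) simp_all

section \<open>Timed semantics and verification rules\<close>

context
  fixes x :: "nat list" and M :: nat
begin

text \<open>Sums have to stay below \<open>M\<close>, so that \<open>M\<close> bounds all values; the third argument counts
  the executed commands and tests.\<close>

inductive steps :: "com \<Rightarrow> vars \<times> arrs \<Rightarrow> nat \<Rightarrow> vars \<times> arrs \<Rightarrow> bool" where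
  Const: "c < M \<Longrightarrow> steps (Const v c) (s, A) 1 (s(v := c), A)"
| Plus: "s u + s w < M \<Longrightarrow> steps (Plus v u w) (s, A) 1 (s(v := s u + s w), A)"
| Minus: "steps (Minus v u w) (s, A) 1 (s(v := s u - s w), A)"
| Read: "steps (Read v a i) (s, A) 1 (s(v := A a (s i)), A)"
| Write: "steps (Write a i v) (s, A) 1 (s, A(a := (A a)(s i := s v)))"
| Input: "steps (Input v i) (s, A) 1 (s(v := input_at x (s i)), A)"
| Seq: "steps c \<sigma> t \<sigma>' \<Longrightarrow> steps d \<sigma>' t' \<sigma>'' \<Longrightarrow> steps (c ;; d) \<sigma> (t + t') \<sigma>''"
| If_True: "s v < s w \<Longrightarrow> steps c (s, A) t \<sigma> \<Longrightarrow> steps (IfLess v w c d) (s, A) (t + 1) \<sigma>"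
| If_False: "\<not> s v < s w \<Longrightarrow> steps d (s, A) t \<sigma> \<Longrightarrow> steps (IfLess v w c d) (s, A) (t + 1) \<sigma>"
| While_True: "s v < s w \<Longrightarrow> steps c (s, A) t \<sigma> \<Longrightarrow> steps (WhileLess v w c) \<sigma> t' \<sigma>'
    \<Longrightarrow> steps (WhileLess v w c) (s, A) (t + t' + 1) \<sigma>'"
| While_False: "\<not> s v < s w \<Longrightarrow> steps (WhileLess v w c) (s, A) 1 (s, A)"

text \<open>Commands are deterministic, so the existential form amounts to total correctness. The
  postcondition sees the number of steps, and \<open>steps\<close> already demands that constants
  and sums stay below \<open>M\<close>.\<close>

definition wp :: "com \<Rightarrow> (nat \<Rightarrow> vars \<Rightarrow> arrs \<Rightarrow> bool) \<Rightarrow> vars \<Rightarrow> arrs \<Rightarrow> bool" where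
  "wp c P s A \<longleftrightarrow> (\<exists>t s' A'. steps c (s, A) t (s', A') \<and> P t s' A')"

inductive_cases steps_elims:
  "steps (Const v c) \<sigma> t \<sigma>'" "steps (Plus v u w) \<sigma> t \<sigma>'" "steps (Minus v u w) \<sigma> t \<sigma>'"
  "steps (Read v a i) \<sigma> t \<sigma>'" "steps (Write a i v) \<sigma> t \<sigma>'" "steps (Input v i) \<sigma> t \<sigma>'"
  "steps (c ;; d) \<sigma> t \<sigma>'" "steps (IfLess v w c d) \<sigma> t \<sigma>'"

text \<open>Equivalences rather than implications, so that the simplifier can compute preconditions
  of straight-line code.\<close>

lemma wp_basic:
  "wp (Const v k) P s A \<longleftrightarrow> k < M \<and> P 1 (s(v := k)) A"
  "wp (Plus v u w) P s A \<longleftrightarrow> s u + s w < M \<and> P 1 (s(v := s u + s w)) A"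
  "wp (Minus v u w) P s A \<longleftrightarrow> P 1 (s(v := s u - s w)) A"
  "wp (Read v a i) P s A \<longleftrightarrow> P 1 (s(v := A a (s i))) A"
  "wp (Write a i v) P s A \<longleftrightarrow> P 1 s (A(a := (A a)(s i := s v)))"
  "wp (Input v i) P s A \<longleftrightarrow> P 1 (s(v := input_at x (s i))) A"
  "wp (c ;; d) P s A \<longleftrightarrow> wp c (\<lambda>t. wp d (\<lambda>t'. P (t + t'))) s A"
  unfolding wp_def by (fastforce intro: steps.intros elim!: steps_elims)+

lemma wp_if:
  "wp (IfLess v w c d) P s A \<longleftrightarrow>
     (if s v < s w then wp c (\<lambda>t. P (t + 1)) s A else wp d (\<lambda>t. P (t + 1)) s A)"
  unfolding wp_def
  by (cases "s v < s w") (fastforce intro: If_True[simplified] If_False[simplified] elim!: steps_elims)+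

lemmas wp_simps = wp_basic wp_if

lemma wp_mono:
  "wp c P s A \<Longrightarrow> (\<And>t s' A'. P t s' A' \<Longrightarrow> P' t s' A') \<Longrightarrow> wp c P' s A"
  unfolding wp_def by blast

text \<open>\<open>Inv\<close> is indexed by the number of completed iterations; \<open>m\<close>
  bounds this number and \<open>b\<close> the time of the body. The extra unit in
  \<open>b + 1\<close> pays for the test of each iteration, the final one for the test that
  fails.\<close>

lemma wp_while:
  assumes "Inv 0 s A"
    and body: "\<And>t s A. Inv t s A \<Longrightarrow> s v < s w \<Longrightarrow>
      t < m \<and> wp c (\<lambda>\<tau> s A. \<tau> \<le> b \<and> Inv (Suc t) s A) s A"
    and final: "\<And>t s A \<tau>. Inv t s A \<Longrightarrow> \<not> s v < s w \<Longrightarrow> \<tau> \<le> m * (b + 1) + 1 \<Longrightarrow> P \<tau> s A"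
  shows "wp (WhileLess v w c) P s A"
proof -
  \<comment> \<open>Generalised to a start after \<open>t\<close> iterations, for induction on
    \<open>m - t\<close>.\<close>
  have *: "\<exists>\<tau> s' A'. steps (WhileLess v w c) (s, A) \<tau> (s', A') \<and> \<not> s' v < s' w \<and>
      (\<exists>t'. Inv t' s' A') \<and> \<tau> \<le> (m - t) * (b + 1) + 1" if "Inv t s A" for t s A
    using that
  proof (induction "m - t" arbitrary: t s A rule: less_induct)
    case less
    show ?case
    proof (cases "s v < s w")
      case False
      with less.prems show ?thesis
        by (intro exI[of _ 1] exI[of _ s] exI[of _ A]) (auto intro: While_False[simplified])
    next
      case True
      from body[OF less.prems True] obtain \<tau> s' A' where
        t: "t < m" and st: "steps c (s, A) \<tau> (s', A')" "\<tau> \<le> b" "Inv (Suc t) s' A'"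
        by (auto simp: wp_def)
      from t have "m - Suc t < m - t" by simp
      from less.hyps[OF this st(3)] obtain \<tau>' s'' A'' where
        st': "steps (WhileLess v w c) (s', A') \<tau>' (s'', A'')" "\<not> s'' v < s'' w"
          "\<exists>t'. Inv t' s'' A''" "\<tau>' \<le> (m - Suc t) * (b + 1) + 1" by blast
      have "m - t = Suc (m - Suc t)" using t by simp
      then have "\<tau> + \<tau>' + 1 \<le> (m - t) * (b + 1) + 1" using st(2) st'(4) by simp
      with While_True[of s v w c A \<tau> "(s', A')" \<tau>' "(s'', A'')", OF True st(1) st'(1)] st' show ?thesis
        by blast
    qed
  qed
  from *[OF assms(1)] show ?thesis
    unfolding wp_def using final by fastforce
qed

text \<open>Nothing is said about the scratch registers 7 and 15, which compiled code may overwrite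
  freely.\<close>

definition represents :: "vars \<times> arrs \<Rightarrow> memory \<Rightarrow> bool" where
  "represents \<sigma> R \<longleftrightarrow> (\<forall>v. R (reg v) = fst \<sigma> v \<and> fst \<sigma> v < M) \<and>
     (\<forall>a i. R (cell a i) = snd \<sigma> a i \<and> snd \<sigma> a i < M)"

end

section \<open>Simulation on the machine and its cost\<close>

definition code_at :: "program \<Rightarrow> nat \<Rightarrow> program \<Rightarrow> bool" where
  "code_at P l C \<longleftrightarrow> (\<forall>j<length C. l + j < length P \<and> P ! (l + j) = C ! j)"

lemma code_at_append:
  "code_at P l (C @ D) \<longleftrightarrow> code_at P l C \<and> code_at P (l + length C) D"
proof
  assume *: "code_at P l (C @ D)"
  have "l + j < length P \<and> P ! (l + j) = C ! j" if "j < length C" for j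
    using *[unfolded code_at_def, rule_format, of j] that by (simp add: nth_append)
  moreover have "l + length C + j < length P \<and> P ! (l + length C + j) = D ! j" if "j < length D" for j
    using *[unfolded code_at_def, rule_format, of "length C + j"] that by (simp add: add.assoc)
  ultimately show "code_at P l C \<and> code_at P (l + length C) D" by (simp add: code_at_def)
next
  assume *: "code_at P l C \<and> code_at P (l + length C) D"
  show "code_at P l (C @ D)" unfolding code_at_def
  proof (intro allI impI)
    fix j assume j: "j < length (C @ D)"
    show "l + j < length P \<and> P ! (l + j) = (C @ D) ! j"
    proof (cases "j < length C")
      case True
      with * show ?thesis by (simp add: code_at_def nth_append)
    next
      case False
      with * j show ?thesis unfolding code_at_def
        by (auto simp: nth_append dest!: spec[of _ "j - length C"])
    qed
  qed
qed

lemma code_at_Cons: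
  "code_at P l (i # C) \<longleftrightarrow> l < length P \<and> P ! l = i \<and> code_at P (Suc l) C"
  using code_at_append[of P l "[i]" C] by (simp add: code_at_def)

lemma code_at_Nil: "code_at P l []"
  by (simp add: code_at_def)

text \<open>\<open>run\<close> describes only complete, halting executions. A code fragment is
  therefore described by how it prolongs every halting run from \<open>\<sigma>'\<close> to one from
  \<open>\<sigma>\<close>; this composes without a separate small-step relation.\<close>

definition reaches :: "program \<Rightarrow> nat list \<Rightarrow> nat \<Rightarrow> config \<Rightarrow> config \<Rightarrow> bool" where
  "reaches P x k \<sigma> \<sigma>' \<longleftrightarrow>
     (\<exists>t\<le>k. \<forall>u \<rho>. run P x \<sigma>' u \<rho> \<longrightarrow> run P x \<sigma> (t + u) \<rho>)"

lemma reaches_step: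
  assumes "l < length P" "P ! l = i" "cost x i R \<le> k" "exec x i (l, R) = \<sigma>"
  shows "reaches P x k (l, R) \<sigma>"
  using assms run.step[of l P x R] unfolding reaches_def by blast

lemma reaches_trans:
  assumes "reaches P x k \<sigma> \<sigma>'" "reaches P x k' \<sigma>' \<sigma>''"
  shows "reaches P x (k + k') \<sigma> \<sigma>''"
proof -
  from assms obtain t t' where "t \<le> k" "t' \<le> k'"
    "\<And>u \<rho>. run P x \<sigma>' u \<rho> \<Longrightarrow> run P x \<sigma> (t + u) \<rho>"
    "\<And>u \<rho>. run P x \<sigma>'' u \<rho> \<Longrightarrow> run P x \<sigma>' (t' + u) \<rho>"
    unfolding reaches_def by blast
  then show ?thesis unfolding reaches_def
    by (intro exI[of _ "t + t'"]) (simp add: add.assoc)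
qed

lemma reaches_mono: "reaches P x k \<sigma> \<sigma>' \<Longrightarrow> k \<le> k' \<Longrightarrow> reaches P x k' \<sigma> \<sigma>'"
  unfolding reaches_def by (meson order_trans)

text \<open>An instruction names at most three registers with at most 8 digits each and uses at most
  two operands with at most \<open>b + 4\<close> digits each, \<open>2 * b + 32\<close> in total.
  The 4 additional digits are for the addresses of array cells.\<close>

definition unit_cost :: "nat \<Rightarrow> nat" where
  "unit_cost b = 2 * b + 40"

lemma bits_le: "a < 2 ^ b \<Longrightarrow> 1 \<le> b \<Longrightarrow> bits a \<le> b"
  by (simp add: bits_def floorlog_le_iff)

lemma bits_small: "a < 256 \<Longrightarrow> bits a \<le> 8"
  using bits_le[of a 8] by simp

lemma bits_reg: "bits (reg v) \<le> 8"
  using var_id_le[of v] by (intro bits_small) (simp add: reg_def)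

lemmas bits_7 = bits_small[of 7, simplified] and bits_15 = bits_small[of 15, simplified]

lemma bits_arr_id: "bits (arr_id a) \<le> 8"
  using arr_id_bounds[of a] by (intro bits_small) simp

lemma cell_less: "i < 2 ^ b \<Longrightarrow> cell a i < 2 ^ (b + 4)"
  using arr_id_bounds[of a] by (simp add: cell_def power_add)

lemma compare_reaches:
  assumes "represents (2 ^ b) \<sigma> R" "1 \<le> b"
    and "code_at P l [Sub 7 (reg w) (reg v), JumpZero 7 l']"
  shows "\<exists>R'. represents (2 ^ b) \<sigma> R' \<and> reaches P x (2 * unit_cost b) (l, R)
    (if fst \<sigma> v < fst \<sigma> w then l + 2 else l', R')"
proof -
  let ?R = "R(7 := R (reg w) - R (reg v))"
  have v: "R (reg v) = fst \<sigma> v" "R (reg w) = fst \<sigma> w" "R (reg v) < 2 ^ b" "R (reg w) < 2 ^ b"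
    using assms(1) by (auto simp: represents_def)
  have w: "R (reg w) - R (reg v) < 2 ^ b" using v by simp
  note bd = v(3,4)[THEN bits_le, OF assms(2)] w[THEN bits_le, OF assms(2)] bits_reg[of v] bits_reg[of w] bits_7
  have "reaches P x (unit_cost b) (l, R) (l + 1, ?R)"
    using assms(3) bd by (intro reaches_step) (auto simp: code_at_Cons unit_cost_def)
  moreover have "reaches P x (unit_cost b) (l + 1, ?R)
      (if fst \<sigma> v < fst \<sigma> w then l + 2 else l', ?R)"
    using assms(3) bd by (intro reaches_step) (auto simp: code_at_Cons unit_cost_def v)
  ultimately have "reaches P x (2 * unit_cost b) (l, R)
      (if fst \<sigma> v < fst \<sigma> w then l + 2 else l', ?R)"
    using reaches_trans mult_2 by metis
  moreover have "represents (2 ^ b) \<sigma> ?R" using assms(1) by (simp add: represents_def)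
  ultimately show ?thesis by blast
qed

lemma address_reaches:
  assumes "represents (2 ^ b) \<sigma> R" "1 \<le> b" "code_at P l (address a i)"
  shows "\<exists>R'. represents (2 ^ b) \<sigma> R' \<and> R' 7 = cell a (fst \<sigma> i) \<and>
    reaches P x (5 * unit_cost b) (l, R) (l + 5, R')"
proof -
  let ?c = "fst \<sigma> i"
  let ?R1 = "R(7 := 2 * ?c)" and ?R2 = "R(7 := 4 * ?c)" and ?R3 = "R(7 := 8 * ?c)"
  let ?R4 = "R(7 := 8 * ?c, 15 := arr_id a)" and ?R5 = "R(15 := arr_id a, 7 := cell a ?c)"
  have v: "R (reg i) = ?c" "?c < 2 ^ b" using assms(1) by (auto simp: represents_def)
  then have "8 * ?c < 2 ^ (b + 4)" by (simp add: power_add)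
  then have bd: "bits ?c \<le> b + 4" "bits (2 * ?c) \<le> b + 4" "bits (4 * ?c) \<le> b + 4"
    "bits (8 * ?c) \<le> b + 4" using assms(2) by (auto intro!: bits_le)
  note bd = bd bits_reg[of i] bits_arr_id[of a] bits_7 bits_15
  have c: "l < length P" "P ! l = Add 7 (reg i) (reg i)" "l + 1 < length P" "P ! (l + 1) = Add 7 7 7"
    "l + 2 < length P" "P ! (l + 2) = Add 7 7 7" "l + 3 < length P" "P ! (l + 3) = LoadConst 15 (arr_id a)"
    "l + 4 < length P" "P ! (l + 4) = Add 7 7 15"
    using assms(3)[unfolded code_at_def, rule_format, of 0] assms(3)[unfolded code_at_def, rule_format, of 1]
      assms(3)[unfolded code_at_def, rule_format, of 2] assms(3)[unfolded code_at_def, rule_format, of 3]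
      assms(3)[unfolded code_at_def, rule_format, of 4]
    by (simp_all add: address_def)
  have 1: "reaches P x (unit_cost b) (l, R) (l + 1, ?R1)"
    using bd by (intro reaches_step[OF c(1,2)]) (simp_all add: unit_cost_def v flip: mult_2)
  have 2: "reaches P x (unit_cost b) (l + 1, ?R1) (l + 2, ?R2)"
    using bd by (intro reaches_step[OF c(3,4)]) (simp_all add: unit_cost_def)
  have 3: "reaches P x (unit_cost b) (l + 2, ?R2) (l + 3, ?R3)"
    using bd by (intro reaches_step[OF c(5,6)]) (simp_all add: unit_cost_def)
  have 4: "reaches P x (unit_cost b) (l + 3, ?R3) (l + 4, ?R4)"
    using bd by (intro reaches_step[OF c(7,8)]) (simp_all add: unit_cost_def)
  have 5: "reaches P x (unit_cost b) (l + 4, ?R4) (l + 5, ?R5)"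
    using bd by (intro reaches_step[OF c(9,10)]) (simp_all add: unit_cost_def cell_def fun_upd_twist)
  have "reaches P x (5 * unit_cost b) (l, R) (l + 5, ?R5)"
    using reaches_trans[OF 1 reaches_trans[OF 2 reaches_trans[OF 3 reaches_trans[OF 4 5]]]]
    by (rule reaches_mono) simp
  moreover have "represents (2 ^ b) \<sigma> ?R5" using assms(1) by (simp add: represents_def)
  ultimately show ?thesis by (intro exI[of _ ?R5]) simp
qed

text \<open>Induction along the execution. An array access takes 6 instructions, any other basic
  command 1, and a test at most 3 including the closing jump; this explains the factor 6.\<close>

lemma compile_correct:
  assumes "steps x (2 ^ b) c \<sigma> t \<sigma>'" "1 \<le> b" "\<And>i. input_at x i < 2 ^ b"
    and "represents (2 ^ b) \<sigma> R" "code_at P l (compile l c)"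
  shows "\<exists>R'. represents (2 ^ b) \<sigma>' R' \<and>
    reaches P x (t * (6 * unit_cost b)) (l, R) (l + size_of c, R')"
  using assms(1,4,5)
proof (induction arbitrary: l R rule: steps.induct)
  case (Const k v s A)
  let ?R = "R(reg v := k)"
  have "bits k \<le> b" using Const(1) assms(2) by (rule bits_le)
  then have "reaches P x (6 * unit_cost b) (l, R) (l + 1, ?R)"
    using Const bits_reg[of v] by (intro reaches_step) (auto simp: code_at_Cons unit_cost_def)
  moreover have "represents (2 ^ b) (s(v := k), A) ?R" using Const by (auto simp: represents_def)
  ultimately show ?case by auto
next
  case (Plus s u w v A)
  let ?R = "R(reg v := s u + s w)"
  have r: "R (reg u) = s u" "R (reg w) = s w" "s u < 2 ^ b" "s w < 2 ^ b"
    using Plus by (auto simp: represents_def)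
  then have "reaches P x (6 * unit_cost b) (l, R) (l + 1, ?R)"
    using Plus bits_reg[of u] bits_reg[of v] bits_reg[of w] r(3,4)[THEN bits_le, OF assms(2)]
    by (intro reaches_step) (auto simp: code_at_Cons unit_cost_def)
  moreover have "represents (2 ^ b) (s(v := s u + s w), A) ?R" using Plus by (auto simp: represents_def)
  ultimately show ?case by auto
next
  case (Minus v u w s A)
  let ?R = "R(reg v := s u - s w)"
  have r: "R (reg u) = s u" "R (reg w) = s w" "s u < 2 ^ b" "s w < 2 ^ b"
    using Minus by (auto simp: represents_def)
  then have "reaches P x (6 * unit_cost b) (l, R) (l + 1, ?R)"
    using Minus bits_reg[of u] bits_reg[of v] bits_reg[of w] r(3,4)[THEN bits_le, OF assms(2)]
    by (intro reaches_step) (auto simp: code_at_Cons unit_cost_def)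
  moreover have "represents (2 ^ b) (s(v := s u - s w), A) ?R"
    using Minus by (auto simp: represents_def less_imp_diff_less)
  ultimately show ?case by auto
next
  case (Read v a i s A)
  then have c: "code_at P l (address a i)" "code_at P (l + 5) [Load (reg v) 7]"
    by (simp_all add: code_at_append)
  from address_reaches[OF Read(1) assms(2) c(1)] obtain R1 where
    R1: "represents (2 ^ b) (s, A) R1" "R1 7 = cell a (s i)"
    "reaches P x (5 * unit_cost b) (l, R) (l + 5, R1)" by auto
  have r: "R1 (cell a (s i)) = A a (s i)" "A a (s i) < 2 ^ b" "s i < 2 ^ b"
    using R1 by (auto simp: represents_def)
  have "cell a (s i) < 2 ^ (b + 4)" using r(3) by (rule cell_less)
  then have "bits (cell a (s i)) \<le> b + 4" using assms(2) by (intro bits_le) auto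
  then have "reaches P x (unit_cost b) (l + 5, R1) (l + 6, R1(reg v := A a (s i)))"
    using c(2) bits_reg[of v] bits_7 r(2)[THEN bits_le, OF assms(2)]
    by (intro reaches_step[where i = "Load (reg v) 7"]) (auto simp: code_at_Cons unit_cost_def R1 r)
  from reaches_trans[OF R1(3) this]
  have "reaches P x (6 * unit_cost b) (l, R) (l + 6, R1(reg v := A a (s i)))"
    by (rule reaches_mono) simp
  moreover have "represents (2 ^ b) (s(v := A a (s i)), A) (R1(reg v := A a (s i)))"
    using R1 by (auto simp: represents_def)
  ultimately show ?case by auto
next
  case (Write a i v s A)
  then have c: "code_at P l (address a i)" "code_at P (l + 5) [Store 7 (reg v)]"
    by (simp_all add: code_at_append)
  from address_reaches[OF Write(1) assms(2) c(1)] obtain R1 where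
    R1: "represents (2 ^ b) (s, A) R1" "R1 7 = cell a (s i)"
    "reaches P x (5 * unit_cost b) (l, R) (l + 5, R1)" by auto
  let ?R = "R1(cell a (s i) := s v)"
  have r: "R1 (reg v) = s v" "s v < 2 ^ b" "s i < 2 ^ b"
    using R1 by (auto simp: represents_def)
  have "cell a (s i) < 2 ^ (b + 4)" using r(3) by (rule cell_less)
  then have "bits (cell a (s i)) \<le> b + 4" using assms(2) by (intro bits_le) auto
  then have "reaches P x (unit_cost b) (l + 5, R1) (l + 6, ?R)"
    using c(2) bits_reg[of v] bits_7 r(2)[THEN bits_le, OF assms(2)]
    by (intro reaches_step[where i = "Store 7 (reg v)"]) (auto simp: code_at_Cons unit_cost_def R1 r)
  from reaches_trans[OF R1(3) this]
  have "reaches P x (6 * unit_cost b) (l, R) (l + 6, ?R)"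
    by (rule reaches_mono) simp
  moreover have "represents (2 ^ b) (s, A(a := (A a)(s i := s v))) ?R"
    using R1 by (auto simp: represents_def)
  ultimately show ?case by auto
next
  case (Input v i s A)
  let ?R = "R(reg v := input_at x (s i))"
  have r: "R (reg i) = s i" "s i < 2 ^ b"
    using Input by (auto simp: represents_def)
  then have "reaches P x (6 * unit_cost b) (l, R) (l + 1, ?R)"
    using Input bits_reg[of i] bits_reg[of v] r(2)[THEN bits_le, OF assms(2)]
      assms(3)[THEN bits_le, OF assms(2), of "s i"]
    by (intro reaches_step[where i = "ReadInput (reg v) (reg i)"]) (auto simp: code_at_Cons unit_cost_def)
  moreover have "represents (2 ^ b) (s(v := input_at x (s i)), A) ?R"
    using Input assms(3) by (auto simp: represents_def)
  ultimately show ?case by auto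
next
  case (Seq c \<sigma> t \<sigma>' d t' \<sigma>'')
  then have c: "code_at P l (compile l c)" "code_at P (l + size_of c) (compile (l + size_of c) d)"
    by (auto simp: code_at_append)
  from Seq.IH(1)[OF Seq.prems(1) c(1)] obtain R1 where R1: "represents (2 ^ b) \<sigma>' R1"
    "reaches P x (t * (6 * unit_cost b)) (l, R) (l + size_of c, R1)" by blast
  from Seq.IH(2)[OF R1(1) c(2)] obtain R2 where R2: "represents (2 ^ b) \<sigma>'' R2"
    "reaches P x (t' * (6 * unit_cost b)) (l + size_of c, R1) (l + size_of c + size_of d, R2)" by blast
  from reaches_trans[OF R1(2) R2(2)] R2(1) show ?case
    by (auto simp: add_mult_distrib add.assoc)
next
  case (If_True s v w c A t \<sigma> d)
  then have c: "code_at P l [Sub 7 (reg w) (reg v), JumpZero 7 (l + size_of c + 3)]"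
    "code_at P (l + 2) (compile (l + 2) c)"
    "code_at P (l + 2 + size_of c) [Jump (l + size_of c + size_of d + 3)]"
    by (auto simp: code_at_append code_at_Cons code_at_Nil numeral_2_eq_2)
  from compare_reaches[OF If_True.prems(1) assms(2) c(1)] If_True.hyps(1) obtain R1 where
    R1: "represents (2 ^ b) (s, A) R1" "reaches P x (2 * unit_cost b) (l, R) (l + 2, R1)" by auto
  from If_True.IH[OF R1(1) c(2)] obtain R2 where R2: "represents (2 ^ b) \<sigma> R2"
    "reaches P x (t * (6 * unit_cost b)) (l + 2, R1) (l + 2 + size_of c, R2)" by blast
  have "reaches P x (unit_cost b) (l + 2 + size_of c, R2) (l + size_of c + size_of d + 3, R2)"
    using c(3) by (intro reaches_step) (auto simp: code_at_Cons unit_cost_def)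
  from reaches_trans[OF R1(2) reaches_trans[OF R2(2) this]]
  have "reaches P x ((t + 1) * (6 * unit_cost b)) (l, R) (l + size_of c + size_of d + 3, R2)"
    by (rule reaches_mono) (simp add: algebra_simps)
  with R2(1) show ?case by (auto simp: add.assoc)
next
  case (If_False s v w d A t \<sigma> c)
  then have c: "code_at P l [Sub 7 (reg w) (reg v), JumpZero 7 (l + size_of c + 3)]"
    "code_at P (l + size_of c + 3) (compile (l + size_of c + 3) d)"
    by (auto simp: code_at_append code_at_Cons code_at_Nil eval_nat_numeral)
  from compare_reaches[OF If_False.prems(1) assms(2) c(1)] If_False.hyps(1) obtain R1 where
    R1: "represents (2 ^ b) (s, A) R1"
      "reaches P x (2 * unit_cost b) (l, R) (l + size_of c + 3, R1)" by auto
  from If_False.IH[OF R1(1) c(2)] obtain R2 where R2: "represents (2 ^ b) \<sigma> R2"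
    "reaches P x (t * (6 * unit_cost b)) (l + size_of c + 3, R1) (l + size_of c + 3 + size_of d, R2)"
    by blast
  from reaches_trans[OF R1(2) R2(2)]
  have "reaches P x ((t + 1) * (6 * unit_cost b)) (l, R) (l + size_of c + 3 + size_of d, R2)"
    by (rule reaches_mono) (simp add: algebra_simps)
  with R2(1) show ?case by (auto simp: ac_simps)
next
  case (While_True s v w c A t \<sigma> t' \<sigma>')
  then have c: "code_at P l [Sub 7 (reg w) (reg v), JumpZero 7 (l + size_of c + 3)]"
    "code_at P (l + 2) (compile (l + 2) c)" "code_at P (l + 2 + size_of c) [Jump l]"
    by (auto simp: code_at_append code_at_Cons code_at_Nil numeral_2_eq_2)
  from compare_reaches[OF While_True.prems(1) assms(2) c(1)] While_True.hyps(1) obtain R1 where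
    R1: "represents (2 ^ b) (s, A) R1" "reaches P x (2 * unit_cost b) (l, R) (l + 2, R1)" by auto
  from While_True.IH(1)[OF R1(1) c(2)] obtain R2 where R2: "represents (2 ^ b) \<sigma> R2"
    "reaches P x (t * (6 * unit_cost b)) (l + 2, R1) (l + 2 + size_of c, R2)" by blast
  have R3: "reaches P x (unit_cost b) (l + 2 + size_of c, R2) (l, R2)"
    using c(3) by (intro reaches_step) (auto simp: code_at_Cons unit_cost_def)
  from While_True.IH(2)[OF R2(1) While_True.prems(2)] obtain R4 where
    R4: "represents (2 ^ b) \<sigma>' R4"
    "reaches P x (t' * (6 * unit_cost b)) (l, R2) (l + size_of (WhileLess v w c), R4)" by blast
  from reaches_trans[OF R1(2) reaches_trans[OF R2(2) reaches_trans[OF R3 R4(2)]]]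
  have "reaches P x ((t + t' + 1) * (6 * unit_cost b)) (l, R) (l + size_of (WhileLess v w c), R4)"
    by (rule reaches_mono) (simp add: algebra_simps)
  with R4(1) show ?case by blast
next
  case (While_False s v w c A)
  then have c: "code_at P l [Sub 7 (reg w) (reg v), JumpZero 7 (l + size_of c + 3)]"
    by (auto simp: code_at_append code_at_Cons code_at_Nil)
  from compare_reaches[OF While_False.prems(1) assms(2) c(1)] While_False.hyps obtain R1 where
    R1: "represents (2 ^ b) (s, A) R1"
      "reaches P x (2 * unit_cost b) (l, R) (l + size_of c + 3, R1)" by auto
  from R1(2) have "reaches P x (1 * (6 * unit_cost b)) (l, R) (l + size_of c + 3, R1)"
    by (rule reaches_mono) simp
  with R1(1) show ?case by (auto simp: add.assoc)
qed

text \<open>The interface between the two levels: correctness and step counts are proved for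
  structured programs, and machine time differs from the step count by a factor linear in the word
  length \<open>b\<close>.\<close>

theorem wp_computes_in_time:
  assumes "wp x (2 ^ b) c (\<lambda>t s A. t \<le> k \<and> s vRes = y) (\<lambda>_. 0) (\<lambda>_ _. 0)"
    and "1 \<le> b" "\<And>i. input_at x i < 2 ^ b"
  shows "\<exists>t \<le> k * (6 * unit_cost b). computes_in_time (compile 0 c) x y t"
proof -
  from assms(1) obtain t s A where st: "steps x (2 ^ b) c (\<lambda>_. 0, \<lambda>_ _. 0) t (s, A)" "t \<le> k"
    "s vRes = y" by (auto simp: wp_def)
  have "represents (2 ^ b) (\<lambda>_. 0, \<lambda>_ _. 0) (\<lambda>_. 0)" by (simp add: represents_def)
  moreover have "code_at (compile 0 c) 0 (compile 0 c)" by (simp add: code_at_def)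
  ultimately obtain R where R: "represents (2 ^ b) (s, A) R"
    "reaches (compile 0 c) x (t * (6 * unit_cost b)) (0, \<lambda>_. 0) (0 + size_of c, R)"
    using compile_correct[OF st(1) assms(2,3)] by blast
  have "run (compile 0 c) x (size_of c, R) 0 (size_of c, R)" by (rule run.halt) simp
  with R(2) obtain u where u: "u \<le> t * (6 * unit_cost b)"
    "run (compile 0 c) x (0, \<lambda>_. 0) u (size_of c, R)" unfolding reaches_def by fastforce
  have "R (reg vRes) = y" using R(1) st(3) by (simp add: represents_def)
  then have "R 0 = y" by (simp add: reg_def)
  with u have "computes_in_time (compile 0 c) x y u" by (auto simp: computes_in_time_def)
  moreover have "u \<le> k * (6 * unit_cost b)" using u(1) st(2) by (meson mult_le_mono1 order_trans)
  ultimately show ?thesis by blast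
qed

section \<open>Canonical forms of tuples\<close>

text \<open>Step \<open>t\<close> of the search multiplies the element number \<open>t div k\<close> by the generator number
  \<open>t mod k\<close>, where \<open>k\<close> is the number of generators.  It starts with a generator instead of the unit,
  which need not be known.\<close>

fun bfs :: "('a \<Rightarrow> 'a \<Rightarrow> 'a) \<Rightarrow> 'a list \<Rightarrow> nat \<Rightarrow> 'a list" where
  "bfs f g 0 = [g ! 0]"
| "bfs f g (Suc t) =
     (let L = bfs f g t; v = f (L ! (t div length g)) (g ! (t mod length g))
      in if v \<in> set L then L else L @ [v])"

definition visit :: "('a \<Rightarrow> 'a \<Rightarrow> 'a) \<Rightarrow> 'a list \<Rightarrow> nat \<Rightarrow> 'a" where
  "visit f g t = f (bfs f g t ! (t div length g)) (g ! (t mod length g))"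

text \<open>Counting starts at 1 because 0 in \<open>aIdx\<close> means that an element has not been
  visited.\<close>

definition label :: "'a list \<Rightarrow> 'a \<Rightarrow> nat" where
  "label L v = Suc (length (takeWhile (\<lambda>y. y \<noteq> v) L))"

text \<open>Read off after the step, so that a newly found element has a label as well. The digits
  thus list the targets of all edges of the Cayley graph, ordered by source and then by
  generator.\<close>

definition digit :: "('a \<Rightarrow> 'a \<Rightarrow> 'a) \<Rightarrow> 'a list \<Rightarrow> nat \<Rightarrow> nat" where
  "digit f g t = label (bfs f g (Suc t)) (visit f g t)"

text \<open>The leading 1 makes the number of digits recoverable. The base \<open>2 ^ n\<close>
  exceeds every digit and allows a shift by \<open>n\<close> doublings.\<close>

primrec code :: "nat \<Rightarrow> ('a \<Rightarrow> 'a \<Rightarrow> 'a) \<Rightarrow> 'a list \<Rightarrow> nat \<Rightarrow> nat" where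
  "code n f g 0 = 1"
| "code n f g (Suc t) = code n f g t * 2 ^ n + digit f g t"

text \<open>Every step before \<open>t\<close> still had an element to process, so no list access
  was out of range. \<open>stops\<close> adds that the queue is now exhausted, which happens at a
  single \<open>t\<close>.\<close>

definition running :: "('a \<Rightarrow> 'a \<Rightarrow> 'a) \<Rightarrow> 'a list \<Rightarrow> nat \<Rightarrow> bool" where
  "running f g t \<longleftrightarrow> (\<forall>s<t. s < length g * length (bfs f g s))"

definition stops :: "('a \<Rightarrow> 'a \<Rightarrow> 'a) \<Rightarrow> 'a list \<Rightarrow> nat \<Rightarrow> bool" where
  "stops f g t \<longleftrightarrow> running f g t \<and> t = length g * length (bfs f g t)"

lemma bfs_Suc:
  "bfs f g (Suc t) = (if visit f g t \<in> set (bfs f g t) then bfs f g t else bfs f g t @ [visit f g t])"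
  by (simp add: visit_def Let_def)

declare bfs.simps(2) [simp del]

lemma distinct_bfs: "distinct (bfs f g t)"
  by (induction t) (simp_all add: bfs_Suc)

lemma visit_in_bfs_Suc: "visit f g t \<in> set (bfs f g (Suc t))"
  by (simp add: bfs_Suc)

lemma bfs_prefix: "s \<le> t \<Longrightarrow> \<exists>L. bfs f g t = bfs f g s @ L"
proof (induction t)
  case (Suc t)
  then show ?case
    by (cases "s = Suc t") (auto simp: bfs_Suc)
qed simp

lemma nth_bfs: "s \<le> t \<Longrightarrow> j < length (bfs f g s) \<Longrightarrow> bfs f g t ! j = bfs f g s ! j"
  using bfs_prefix[of s t f g] by (auto simp: nth_append)

lemma label_le: "v \<in> set L \<Longrightarrow> label L v \<le> length L"
  by (induction L) (auto simp: label_def)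

lemma nth_label: "v \<in> set L \<Longrightarrow> L ! (label L v - 1) = v"
  by (induction L) (auto simp: label_def)

lemma label_nth: "distinct L \<Longrightarrow> j < length L \<Longrightarrow> label L (L ! j) = Suc j"
proof -
  assume *: "distinct L" "j < length L"
  then have "L ! (label L (L ! j) - 1) = L ! j" "label L (L ! j) \<le> length L"
    using nth_label[of "L ! j" L] label_le[of "L ! j" L] by simp_all
  with * show ?thesis by (simp add: label_def nth_eq_iff_index_eq)
qed

lemma label_append: "v \<in> set L \<Longrightarrow> label (L @ L') v = label L v"
  by (induction L) (auto simp: label_def)

lemma label_snoc: "v \<notin> set L \<Longrightarrow> label (L @ [v]) v = Suc (length L)"
  by (induction L) (auto simp: label_def)

lemma label_map:
  "inj_on \<phi> S \<Longrightarrow> set L \<subseteq> S \<Longrightarrow> v \<in> S \<Longrightarrow> label (map \<phi> L) (\<phi> v) = label L v"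
  by (induction L) (auto simp: label_def inj_on_eq_iff)

lemma visit_index:
  "t < length g * length (bfs f g t) \<Longrightarrow> t div length g < length (bfs f g t) \<and> t mod length g < length g"
  by (cases "g = []") (auto simp: less_mult_imp_div_less mult.commute)

text \<open>By the time of stopping, element \<open>j\<close> has been multiplied by generator
  \<open>i\<close>, namely in step \<open>j * length g + i\<close>. Labels never change once given,
  so the digit of that step names the product in the final list.\<close>

lemma stops_visit:
  assumes "stops f g t" "j < length (bfs f g t)" "i < length g"
  shows "j * length g + i < t"
    and "visit f g (j * length g + i) = f (bfs f g t ! j) (g ! i)"
    and "bfs f g t ! (digit f g (j * length g + i) - 1) = f (bfs f g t ! j) (g ! i)"
    and "digit f g (j * length g + i) - 1 < length (bfs f g t)"
proof -
  let ?s = "j * length g + i"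
  have g: "g \<noteq> []" using assms(3) by auto
  have "?s < Suc j * length g" using assms(3) by simp
  also have "\<dots> \<le> length (bfs f g t) * length g" using assms(2) by (intro mult_le_mono1) simp
  also have "\<dots> = t" using assms(1) by (simp add: stops_def mult.commute)
  finally show s: "?s < t" .
  have "?s < length g * length (bfs f g ?s)" using assms(1) s by (simp add: stops_def running_def)
  from visit_index[OF this] g assms(3) have j: "j < length (bfs f g ?s)" by simp
  then have "bfs f g t ! j = bfs f g ?s ! j" using nth_bfs s by (metis less_imp_le)
  then show v: "visit f g ?s = f (bfs f g t ! j) (g ! i)" using assms(3) g by (simp add: visit_def)
  obtain L where L: "bfs f g t = bfs f g (Suc ?s) @ L" using bfs_prefix s by (metis Suc_leI)
  then have d: "digit f g ?s = label (bfs f g t) (visit f g ?s)"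
    by (simp add: digit_def label_append visit_in_bfs_Suc)
  have m: "visit f g ?s \<in> set (bfs f g t)" using L visit_in_bfs_Suc[of f g ?s] by simp
  show "bfs f g t ! (digit f g ?s - 1) = f (bfs f g t ! j) (g ! i)"
    using nth_label[OF m] v d by simp
  show "digit f g ?s - 1 < length (bfs f g t)" using label_le[OF m] d by (simp add: label_def)
qed

text \<open>The program compares the quotient with the length. A failed test gives one inequality;
  the other holds because the step before \<open>t\<close> still had something to process and the
  list never shrinks.\<close>

lemma stops_if_not_less:
  assumes "running f g t" "\<not> t div length g < length (bfs f g t)" "g \<noteq> []"
  shows "stops f g t"
proof -
  have ge: "length g * length (bfs f g t) \<le> t"
    using assms by (simp add: div_less_iff_less_mult mult.commute not_less)
  have "t \<le> length g * length (bfs f g t)"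
  proof (cases t)
    case (Suc u)
    then have "u < length g * length (bfs f g u)" using assms(1) by (simp add: running_def)
    also have "\<dots> \<le> length g * length (bfs f g t)"
      using bfs_prefix[of u t f g] Suc by auto
    finally show ?thesis using Suc by simp
  qed simp
  with ge assms(1) show ?thesis by (simp add: stops_def)
qed

lemma stops_unique: "stops f g t \<Longrightarrow> stops f g t' \<Longrightarrow> t = t'"
  unfolding stops_def running_def by (metis less_irrefl linorder_neqE_nat)

lemma bfs_subset:
  assumes "g \<noteq> []" "set g \<subseteq> S" "\<And>a b. a \<in> S \<Longrightarrow> b \<in> S \<Longrightarrow> f a b \<in> S" "running f g t"
  shows "set (bfs f g t) \<subseteq> S"
  using assms(4)
proof (induction t)
  case 0
  then show ?case using assms(1,2) by auto
next
  case (Suc t)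
  then have "set (bfs f g t) \<subseteq> S" "t < length g * length (bfs f g t)" by (auto simp: running_def)
  with visit_index[OF this(2)] assms have "visit f g t \<in> S"
    unfolding visit_def by (meson nth_mem subsetD)
  with \<open>set (bfs f g t) \<subseteq> S\<close> show ?case by (simp add: bfs_Suc)
qed

text \<open>The visited set is closed under right multiplication by generators. On a finite set
  these maps are permutations, which gives closure under inverses of generators and hence under the
  whole generated subgroup.\<close>

lemma (in group) set_bfs:
  assumes "finite (carrier G)" "g \<noteq> []" "set g \<subseteq> carrier G" "stops (\<otimes>) g t"
  shows "set (bfs (\<otimes>) g t) = generate G (set g)"
proof
  let ?L = "set (bfs (\<otimes>) g t)"
  show "?L \<subseteq> generate G (set g)"
    using assms generate.incl generate.eng[of _ G "set g"] by (intro bfs_subset) (auto simp: stops_def)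
  have L: "?L \<subseteq> carrier G" using assms by (intro bfs_subset) (auto simp: stops_def)
  have fin: "finite ?L" by simp
  have closed: "\<forall>y\<in>?L. y \<otimes> z \<in> ?L" if "z \<in> generate G (set g)" for z
    using that
  proof (induction rule: generate.induct)
    case one
    then show ?case using L by auto
  next
    case (incl z)
    show ?case
    proof
      fix y assume "y \<in> ?L"
      with incl obtain i j where "i < length g" "z = g ! i" "j < length (bfs (\<otimes>) g t)"
        "y = bfs (\<otimes>) g t ! j" by (metis in_set_conv_nth)
      with stops_visit(3,4)[OF assms(4), of j i] show "y \<otimes> z \<in> ?L" by (metis nth_mem)
    qed
  next
    case (inv z)
    then have z: "z \<in> carrier G" using assms(3) by auto
    show ?case
    proof
      fix y assume y: "y \<in> ?L"
      have "(\<lambda>y. y \<otimes> z) ` ?L \<subseteq> ?L"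
      proof clarify
        fix y assume "y \<in> ?L"
        with inv obtain i j where "i < length g" "z = g ! i" "j < length (bfs (\<otimes>) g t)"
          "y = bfs (\<otimes>) g t ! j" by (metis in_set_conv_nth)
        with stops_visit(3,4)[OF assms(4), of j i] show "y \<otimes> z \<in> ?L" by (metis nth_mem)
      qed
      moreover have "inj_on (\<lambda>y. y \<otimes> z) ?L"
        using L z by (intro inj_onI) (metis right_cancel subsetD)
      ultimately have "(\<lambda>y. y \<otimes> z) ` ?L = ?L" using fin by (metis endo_inj_surj)
      with y obtain y' where "y' \<in> ?L" "y = y' \<otimes> z" by (metis imageE)
      then have "y \<otimes> inv z = y'" using L z by (auto simp: m_assoc)
      then show "y \<otimes> inv z \<in> ?L" using \<open>y' \<in> ?L\<close> by simp
    qed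
  next
    case (eng y z)
    have "y \<in> carrier G" "z \<in> carrier G"
      using eng.hyps generate_in_carrier[OF assms(3)] by auto
    moreover have "a \<otimes> (y \<otimes> z) = a \<otimes> y \<otimes> z" if "a \<in> ?L" for a
      using calculation that L by (simp add: m_assoc subset_iff)
    ultimately show ?case using eng.IH by simp
  qed
  have g0: "g ! 0 \<in> set g" using assms(2) by simp
  obtain L' where "bfs (\<otimes>) g t = bfs (\<otimes>) g 0 @ L'" using bfs_prefix by blast
  then have "g ! 0 \<in> ?L" by simp
  \<comment> \<open>The search starts at a generator, so the unit has to be recovered as
    \<open>g ! 0\<close> times its inverse.\<close>
  then have "g ! 0 \<otimes> inv (g ! 0) \<in> ?L" using closed g0 generate.inv by metis
  then have "\<one> \<in> ?L" using g0 assms(3) by auto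
  show "generate G (set g) \<subseteq> ?L"
  proof
    fix z assume z: "z \<in> generate G (set g)"
    with closed \<open>\<one> \<in> ?L\<close> have "\<one> \<otimes> z \<in> ?L" by blast
    then show "z \<in> ?L" using z generate_in_carrier[OF assms(3)] by simp
  qed
qed

text \<open>Isomorphism invariance of the code: an injective map that respects products makes the
  search take the same decision in every step. \<open>running\<close> excludes accesses beyond the
  end of a list, whose values the map need not respect.\<close>

lemma bfs_map:
  assumes "g \<noteq> []" "set g \<subseteq> S" "\<And>a b. a \<in> S \<Longrightarrow> b \<in> S \<Longrightarrow> f a b \<in> S"
    and "inj_on \<phi> S" "\<And>a b. a \<in> S \<Longrightarrow> b \<in> S \<Longrightarrow> \<phi> (f a b) = f' (\<phi> a) (\<phi> b)"
    and "running f g t"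
  shows "bfs f' (map \<phi> g) t = map \<phi> (bfs f g t) \<and>
    code n f' (map \<phi> g) t = code n f g t \<and> running f' (map \<phi> g) t"
  using assms(6)
proof (induction t)
  case 0
  then show ?case using assms(1) by (simp add: running_def)
next
  case (Suc t)
  then have r: "running f g t" and t: "t < length g * length (bfs f g t)"
    by (auto simp: running_def)
  with Suc.IH have IH: "bfs f' (map \<phi> g) t = map \<phi> (bfs f g t)"
    "code n f' (map \<phi> g) t = code n f g t" "running f' (map \<phi> g) t" by auto
  have S: "set (bfs f g t) \<subseteq> S" using bfs_subset[OF assms(1-3) r] by simp
  have vi: "t div length g < length (bfs f g t)" "t mod length g < length g" using visit_index[OF t] by auto
  then have v: "visit f g t \<in> S" using assms(2,3) S unfolding visit_def by (meson nth_mem subsetD)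
  have v': "visit f' (map \<phi> g) t = \<phi> (visit f g t)"
    using vi assms(2,5) S unfolding visit_def IH(1) by (simp add: nth_mem subsetD)
  have "(\<phi> (visit f g t) \<in> \<phi> ` set (bfs f g t)) = (visit f g t \<in> set (bfs f g t))"
    using assms(4) v S by (meson inj_on_image_mem_iff)
  then have b: "bfs f' (map \<phi> g) (Suc t) = map \<phi> (bfs f g (Suc t))"
    by (simp add: bfs_Suc IH(1) v')
  moreover have "set (bfs f g (Suc t)) \<subseteq> S" using S v by (simp add: bfs_Suc)
  then have "digit f' (map \<phi> g) t = digit f g t"
    using label_map[OF assms(4) _ v] unfolding digit_def b v' by simp
  moreover have "running f' (map \<phi> g) (Suc t)"
    using IH(1,3) t by (auto simp: running_def less_Suc_eq)
  ultimately show ?case using IH by simp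
qed

section \<open>The code as an injective encoding\<close>

lemma digit_le:
  assumes "finite S" "card S \<le> n" "set (bfs f g (Suc t)) \<subseteq> S"
  shows "digit f g t \<le> n"
proof -
  have "digit f g t \<le> length (bfs f g (Suc t))"
    unfolding digit_def by (rule label_le[OF visit_in_bfs_Suc])
  also have "\<dots> = card (set (bfs f g (Suc t)))" using distinct_bfs by (metis distinct_card)
  also have "\<dots> \<le> n" using assms by (meson card_mono order_trans)
  finally show ?thesis .
qed

lemma code_less:
  assumes "\<And>s. s < t \<Longrightarrow> digit f g s < 2 ^ n"
  shows "code n f g t < 2 ^ (n * t + 1)"
  using assms
proof (induction t)
  case (Suc t)
  then have "code n f g t + 1 \<le> 2 ^ (n * t + 1)" by (simp add: Suc_le_eq)
  then have "(code n f g t + 1) * 2 ^ n \<le> 2 ^ (n * t + 1) * 2 ^ n" by (rule mult_le_mono1)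
  moreover have "digit f g t < 2 ^ n" using Suc.prems by simp
  moreover have "(2::nat) ^ (n * Suc t + 1) = 2 ^ (n * t + 1) * 2 ^ n" by (simp add: power_add)
  ultimately show ?case by simp
qed simp

lemma code_pos: "code n f g t \<ge> 1"
  by (induction t) (simp_all add: trans_le_add1)

text \<open>Digits are recovered by division with remainder by \<open>2 ^ n\<close>. A sequence with
  at least one digit has a code of at least \<open>2 ^ n > 1\<close>, so the lengths agree
  too.\<close>

lemma code_inj:
  assumes "code n f g t = code n f' g' t'" "0 < n"
    and "\<And>s. s < t \<Longrightarrow> digit f g s < 2 ^ n" "\<And>s. s < t' \<Longrightarrow> digit f' g' s < 2 ^ n"
  shows "t = t' \<and> (\<forall>s<t. digit f g s = digit f' g' s)"
  using assms(1,3,4)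
proof (induction t arbitrary: t')
  case 0
  show ?case
  proof (cases t')
    case (Suc u)
    have "(1::nat) < 2 ^ n" using assms(2) less_exp[of n] by linarith
    also have "\<dots> \<le> code n f' g' u * 2 ^ n" using code_pos[of n f' g' u] by simp
    finally show ?thesis using 0 Suc by simp
  qed simp
next
  case (Suc t)
  show ?case
  proof (cases t')
    case 0
    have "(1::nat) < 2 ^ n" using assms(2) less_exp[of n] by linarith
    also have "\<dots> \<le> code n f g t * 2 ^ n" using code_pos[of n f g t] by simp
    finally show ?thesis using 0 Suc by simp
  next
    case (Suc u)
    have d: "digit f g t < 2 ^ n" "digit f' g' u < 2 ^ n" using Suc.prems Suc by auto
    have "code n f g t * 2 ^ n + digit f g t = code n f' g' u * 2 ^ n + digit f' g' u"
      using Suc.prems Suc by simp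
    then have "(code n f g t * 2 ^ n + digit f g t) div 2 ^ n = (code n f' g' u * 2 ^ n + digit f' g' u) div 2 ^ n"
      "(code n f g t * 2 ^ n + digit f g t) mod 2 ^ n = (code n f' g' u * 2 ^ n + digit f' g' u) mod 2 ^ n"
      by simp_all
    then have "code n f g t = code n f' g' u" "digit f g t = digit f' g' u" using d by simp_all
    with Suc.IH[of u] Suc.prems Suc show ?thesis by (auto simp: less_Suc_eq)
  qed
qed

text \<open>Elements in the same position correspond. Commuting with right multiplication by
  generators would determine a homomorphism only up to a left translation; the common starting point
  in \<open>start\<close> removes the translation.\<close>

lemma iso_if_same_cayley_graph:
  fixes G (structure) and H (structure)
  assumes "group G" "group H"
    and L: "distinct L" "set L = carrier G" and L': "distinct L'" "set L' = carrier H"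
    and len: "length L' = length L" "length h = length g" "g \<noteq> []"
    and g: "set g \<subseteq> carrier G" "generate G (set g) = carrier G" and h: "set h \<subseteq> carrier H"
    and start: "L ! 0 = g ! 0" "L' ! 0 = h ! 0"
    and step: "\<And>j i. j < length L \<Longrightarrow> i < length g \<Longrightarrow>
      \<exists>d<length L. L ! j \<otimes> g ! i = L ! d \<and> L' ! j \<otimes>\<^bsub>H\<^esub> h ! i = L' ! d"
  shows "G \<cong> H"
proof -
  interpret G: group G by fact
  interpret H: group H by fact
  define \<phi> where "\<phi> a = L' ! (label L a - 1)" for a
  have \<phi>: "\<phi> (L ! j) = L' ! j" if "j < length L" for j
    using label_nth[OF L(1) that] by (simp add: \<phi>_def)
  have bij: "bij_betw \<phi> (carrier G) (carrier H)"
  proof -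
    have "map \<phi> L = L'" using \<phi> len by (intro nth_equalityI) auto
    then show ?thesis using L L' by (metis bij_betw_def distinct_map set_map)
  qed
  then have cl: "\<phi> a \<in> carrier H" if "a \<in> carrier G" for a using that by (metis bij_betwE)
  have right: "\<phi> (a \<otimes> g ! i) = \<phi> a \<otimes>\<^bsub>H\<^esub> h ! i" if "a \<in> carrier G" "i < length g" for a i
  proof -
    from that(1) obtain j where j: "j < length L" "a = L ! j" by (metis L(2) in_set_conv_nth)
    from step[OF j(1) that(2)] show ?thesis using \<phi> j by metis
  qed
  have gi: "g ! i \<in> carrier G" "h ! i \<in> carrier H" if "i < length g" for i
    using that nth_mem[of i g] nth_mem[of i h] g h len by auto
  have "0 < length L" using L(2) by (metis G.one_closed empty_iff empty_set length_greater_0_conv)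
  then have "\<phi> (g ! 0) = h ! 0" using \<phi>[of 0] start by simp
  then have "\<phi> \<one> \<otimes>\<^bsub>H\<^esub> h ! 0 = h ! 0"
    using right[of "\<one>" 0] gi[of 0] len by simp
  then have one: "\<phi> \<one> = \<one>\<^bsub>H\<^esub>"
    using gi[of 0] len cl[of "\<one>"] H.r_cancel_one by simp
  \<comment> \<open>Induction over the generated subgroup extends the rule from generators to
    arbitrary right factors.\<close>
  have mult: "\<forall>a\<in>carrier G. \<phi> (a \<otimes> b) = \<phi> a \<otimes>\<^bsub>H\<^esub> \<phi> b" if "b \<in> generate G (set g)" for b
    using that
  proof (induction rule: generate.induct)
    case one
    then show ?case using one \<open>\<phi> \<one> = \<one>\<^bsub>H\<^esub>\<close> cl by simp
  next
    case (incl b)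
    then obtain i where i: "i < length g" "b = g ! i" by (metis in_set_conv_nth)
    then have "\<phi> b = h ! i" using right[of "\<one>" i] gi[of i] one by simp
    then show ?case using right i by simp
  next
    case (inv b)
    then obtain i where i: "i < length g" "b = g ! i" by (metis in_set_conv_nth)
    then have b: "\<phi> b = h ! i" "b \<in> carrier G" using right[of "\<one>" i] gi[of i] one by simp_all
    \<comment> \<open>The rule for \<open>inv b\<close> is the rule for \<open>b\<close>, applied to
      \<open>a \<otimes> inv b\<close> and solved.\<close>
    have *: "\<phi> (a \<otimes> inv b) = \<phi> a \<otimes>\<^bsub>H\<^esub> inv\<^bsub>H\<^esub> \<phi> b" if a: "a \<in> carrier G" for a
    proof -
      have "\<phi> (a \<otimes> inv b) \<otimes>\<^bsub>H\<^esub> \<phi> b = \<phi> (a \<otimes> inv b \<otimes> b)" using right[of "a \<otimes> inv b" i] a b i by simp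
      also have "a \<otimes> inv b \<otimes> b = a" using a b by (simp add: G.m_assoc)
      finally show ?thesis using a b cl by (metis G.inv_closed G.m_closed H.inv_solve_right)
    qed
    from *[of "\<one>"] have "\<phi> (inv b) = inv\<^bsub>H\<^esub> \<phi> b" using b one cl gi(2)[OF i(1)] by simp
    then show ?case using * by simp
  next
    case (eng b c)
    have "b \<in> carrier G" "c \<in> carrier G" using eng.hyps g(2) by auto
    then show ?case using eng.IH cl by (simp flip: G.m_assoc) (simp add: H.m_assoc)
  qed
  then have "\<phi> \<in> hom G H" using g(2) cl by (auto simp: hom_def)
  with bij show ?thesis by (auto simp: is_iso_def iso_def)
qed

text \<open>It is enough that the tuple of H is generating: equal codes give equal stopping times,
  and a stopping time is the number of generators times the number of visited elements, so the
  search in G is exhaustive as well.\<close>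

lemma iso_if_same_code:
  fixes G (structure) and H (structure)
  assumes "group G" "group H" and fin: "finite (carrier G)" "card (carrier G) = n"
    "finite (carrier H)" "card (carrier H) = n"
    and g: "set g \<subseteq> carrier G" "g \<noteq> []" and h: "set h \<subseteq> carrier H" "length h = length g"
    and stops: "stops (\<otimes>) g t" "stops (\<otimes>\<^bsub>H\<^esub>) h t'"
    and code: "code n (\<otimes>) g t = code n (\<otimes>\<^bsub>H\<^esub>) h t'"
    and full: "length (bfs (\<otimes>\<^bsub>H\<^esub>) h t') = n"
  shows "G \<cong> H"
proof -
  interpret G: group G by fact
  interpret H: group H by fact
  have run: "running (\<otimes>) g (Suc s)" if "s < t" for s
    using stops(1) that by (auto simp: stops_def running_def)
  have run': "running (\<otimes>\<^bsub>H\<^esub>) h (Suc s)" if "s < t'" for s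
    using stops(2) that by (auto simp: stops_def running_def)
  have h0: "h \<noteq> []" using g h by auto
  have n: "0 < n" using fin(1,2) G.one_closed card_gt_0_iff by fastforce
  have d: "digit (\<otimes>) g s < 2 ^ n" if "s < t" for s
    using digit_le[OF fin(1) eq_imp_le[OF fin(2)] bfs_subset[OF g(2,1) _ run[OF that]]]
      less_exp[of n] by (simp add: le_less_trans)
  have d': "digit (\<otimes>\<^bsub>H\<^esub>) h s < 2 ^ n" if "s < t'" for s
    using digit_le[OF fin(3) eq_imp_le[OF fin(4)] bfs_subset[OF h0 h(1) _ run'[OF that]]]
      less_exp[of n] by (simp add: le_less_trans)
  from code_inj[OF code n d d'] have tt: "t = t'"
    and dd: "\<And>s. s < t \<Longrightarrow> digit (\<otimes>) g s = digit (\<otimes>\<^bsub>H\<^esub>) h s" by auto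
  let ?L = "bfs (\<otimes>) g t" and ?L' = "bfs (\<otimes>\<^bsub>H\<^esub>) h t'"
  have len: "length ?L = n" using stops tt full g h by (auto simp: stops_def)
  have sub: "set ?L \<subseteq> carrier G" "set ?L' \<subseteq> carrier H"
    using bfs_subset[OF g(2,1), of "(\<otimes>)" t] bfs_subset[OF h0 h(1), of "(\<otimes>\<^bsub>H\<^esub>)" t'] stops
    by (simp_all add: stops_def)
  have L: "set ?L = carrier G"
    using sub(1) fin(1,2) len distinct_bfs by (metis card_subset_eq distinct_card)
  have L': "set ?L' = carrier H"
    using sub(2) fin(3,4) full distinct_bfs by (metis card_subset_eq distinct_card)
  have start: "bfs f g t ! 0 = g ! 0" for f :: "'x \<Rightarrow> 'x \<Rightarrow> 'x" and g t
    using nth_bfs[of 0 t 0 f g] by simp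
  show ?thesis
  proof (rule iso_if_same_cayley_graph[OF assms(1,2) distinct_bfs L distinct_bfs L'])
    show "length ?L' = length ?L" "length h = length g" "g \<noteq> []" "set g \<subseteq> carrier G"
      "set h \<subseteq> carrier H" using len full g h by auto
    show "generate G (set g) = carrier G" using G.set_bfs[OF fin(1) g(2,1) stops(1)] L by simp
    show "?L ! 0 = g ! 0" "?L' ! 0 = h ! 0" using start by blast+
    fix j i assume j: "j < length ?L" and i: "i < length g"
    have j': "j < length ?L'" "i < length h" using len full j i h by auto
    have "digit (\<otimes>) g (j * length g + i) = digit (\<otimes>\<^bsub>H\<^esub>) h (j * length h + i)"
      using dd stops_visit(1)[OF stops(1) j i] h(2) by simp
    then show "\<exists>d<length ?L. ?L ! j \<otimes> g ! i = ?L ! d \<and> ?L' ! j \<otimes>\<^bsub>H\<^esub> h ! i = ?L' ! d"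
      using stops_visit(3,4)[OF stops(1) j i] stops_visit(3,4)[OF stops(2) j'] by metis
  qed
qed

section \<open>Greedy generating tuples\<close>

text \<open>Entries before position \<open>j\<close> are free. The first alternative covers the
  entries after the whole group has been reached, when no element outside is left.\<close>

definition greedy :: "('a, 'b) monoid_scheme \<Rightarrow> nat \<Rightarrow> 'a list \<Rightarrow> bool" where
  "greedy G j g \<longleftrightarrow> (\<forall>i. j \<le> i \<and> i < length g \<longrightarrow>
     generate G (set (take i g)) = carrier G \<or> g ! i \<notin> generate G (set (take i g)))"

lemma greedy_snoc:
  "greedy G j (g @ [v]) \<longleftrightarrow> greedy G j g \<and>
     (j \<le> length g \<longrightarrow> generate G (set g) = carrier G \<or> v \<notin> generate G (set g))"
  by (auto simp: greedy_def nth_append less_Suc_eq)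

text \<open>The old subgroup and its coset through \<open>v\<close> are disjoint, of equal size, and
  both contained in the new subgroup.\<close>

lemma (in group) card_generate_insert:
  assumes "finite (carrier G)" "S \<subseteq> carrier G" "v \<in> carrier G" "v \<notin> generate G S"
  shows "2 * card (generate G S) \<le> card (generate G (insert v S))"
proof -
  let ?K = "generate G S" and ?K' = "generate G (insert v S)"
  have K: "?K \<subseteq> carrier G" "?K' \<subseteq> carrier G" using assms generate_incl by auto
  then have fin: "finite ?K" "finite ?K'" using assms(1) finite_subset by blast+
  have "?K \<subseteq> ?K'" by (rule mono_generate) auto
  moreover have "(\<lambda>a. a \<otimes> v) ` ?K \<subseteq> ?K'"
    using \<open>?K \<subseteq> ?K'\<close> by (auto intro!: generate.eng generate.incl[of v])
  moreover have "?K \<inter> (\<lambda>a. a \<otimes> v) ` ?K = {}"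
  proof (rule ccontr)
    assume "?K \<inter> (\<lambda>a. a \<otimes> v) ` ?K \<noteq> {}"
    then obtain a where a: "a \<in> ?K" "a \<otimes> v \<in> ?K" by auto
    have "inv a \<otimes> (a \<otimes> v) \<in> ?K"
      by (rule generate.eng[OF generate_m_inv_closed[OF assms(2) a(1)] a(2)])
    moreover have "inv a \<otimes> (a \<otimes> v) = v" using a(1) K assms(3) by (simp add: subset_iff flip: m_assoc)
    ultimately show False using assms(4) by simp
  qed
  moreover have "card ((\<lambda>a. a \<otimes> v) ` ?K) = card ?K"
    using K assms(3) by (intro card_image inj_onI) (metis right_cancel subsetD)
  ultimately have "card ?K + card ?K \<le> card ?K'"
    using fin by (metis Un_least card_Un_disjoint card_mono finite_imageI)
  then show ?thesis by simp
qed

text \<open>By induction, the first \<open>i\<close> entries generate the whole group or at least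
  \<open>2 ^ (i - 1)\<close> elements. The exponent loses one because the first entry is arbitrary
  and possibly the unit.\<close>

lemma (in group) greedy_generates:
  assumes "finite (carrier G)" "set g \<subseteq> carrier G" "greedy G 1 g" "card (carrier G) \<le> 2 ^ (length g - 1)"
  shows "generate G (set g) = carrier G"
proof -
  have sub: "generate G (set (take i g)) \<subseteq> carrier G" for i
    using assms(2) by (meson generate_incl order_trans set_take_subset)
  have "generate G (set (take i g)) = carrier G \<or> 2 ^ (i - 1) \<le> card (generate G (set (take i g)))"
    if "i \<le> length g" for i
    using that
  proof (induction i)
    case 0
    then show ?case by (simp add: generate_empty)
  next
    case (Suc i)
    have t: "set (take (Suc i) g) = insert (g ! i) (set (take i g))"
      using Suc.prems by (simp add: take_Suc_conv_app_nth)
    have gi: "g ! i \<in> carrier G" using Suc.prems assms(2) nth_mem[of i g] by auto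
    have S: "set (take i g) \<subseteq> carrier G" using assms(2) by (meson order_trans set_take_subset)
    show ?case
    proof (cases "generate G (set (take i g)) = carrier G")
      case True
      then have "carrier G \<subseteq> generate G (set (take (Suc i) g))"
        unfolding t by (metis mono_generate subset_insertI)
      then show ?thesis using sub by blast
    next
      case False
      show ?thesis
      proof (cases "i = 0")
        case True
        have "card (generate G (set (take (Suc i) g))) > 0"
          using sub[of "Suc i"] assms(1) generate.one[of G] by (metis card_gt_0_iff empty_iff finite_subset)
        then show ?thesis using True by simp
      next
        case i: False
        then have "g ! i \<notin> generate G (set (take i g))"
          using assms(3) False Suc.prems unfolding greedy_def
          by (metis One_nat_def Suc_le_eq not_gr_zero)
        from card_generate_insert[OF assms(1) S gi this]
        have "2 * card (generate G (set (take i g))) \<le> card (generate G (set (take (Suc i) g)))"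
          by (simp add: t)
        moreover have "2 ^ (i - 1) \<le> card (generate G (set (take i g)))" using Suc False by auto
        moreover have "(2::nat) ^ i = 2 * 2 ^ (i - 1)" using i by (cases i) auto
        ultimately show ?thesis by simp
      qed
    qed
  qed
  from this[of "length g"] assms sub[of "length g"] show ?thesis
    by (metis card_seteq le_refl order_trans take_all)
qed

text \<open>\<open>b\<close> is the image of \<open>a\<close> followed by a greedy completion. Since
  \<open>\<phi>\<close> transports greediness, \<open>b\<close> is greedy from position 1 and
  generates H; its preimage begins with \<open>a\<close> and has the same code.\<close>

lemma collision:
  fixes G (structure) and H (structure)
  assumes "group G" "group H" and fin: "finite (carrier G)" "card (carrier G) = n"
    "finite (carrier H)" "card (carrier H) = n" "n \<le> 2 ^ (2 * h - 1)" "0 < h"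
    and \<phi>: "\<phi> \<in> iso G H" and a: "length a = h" "set a \<subseteq> carrier G" "greedy G 1 a"
    and b: "length b = 2 * h" "set b \<subseteq> carrier H" "greedy H h b" "take h b = map \<phi> a"
    and stop: "stops (\<otimes>\<^bsub>H\<^esub>) b t"
  shows "length (bfs (\<otimes>\<^bsub>H\<^esub>) b t) = n \<and> (\<exists>x. length x = h \<and> set x \<subseteq> carrier G \<and>
    stops (\<otimes>) (a @ x) t \<and> code n (\<otimes>) (a @ x) t = code n (\<otimes>\<^bsub>H\<^esub>) b t)"
proof -
  interpret G: group G by fact
  interpret H: group H by fact
  interpret \<phi>: group_hom G H \<phi>
    using \<phi> by unfold_locales (simp add: iso_def)
  have bij: "bij_betw \<phi> (carrier G) (carrier H)" using \<phi> by (simp add: iso_def)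
  have gr: "greedy H 1 b" unfolding greedy_def
  proof (intro allI impI)
    fix i assume i: "1 \<le> i \<and> i < length b"
    show "generate H (set (take i b)) = carrier H \<or> b ! i \<notin> generate H (set (take i b))"
    proof (cases "i < h")
      case False
      then show ?thesis using b(3) i by (auto simp: greedy_def)
    next
      case True
      have t: "take i b = map \<phi> (take i a)"
        using b(4) True by (metis min.strict_order_iff take_map take_take)
      have "b ! i = map \<phi> a ! i" using b(4) True by (metis nth_take)
      then have bi: "b ! i = \<phi> (a ! i)" using True a(1) by simp
      have S: "set (take i a) \<subseteq> carrier G" using a(2) by (meson order_trans set_take_subset)
      have g: "generate H (set (take i b)) = \<phi> ` generate G (set (take i a))"
        using \<phi>.generate_img[OF S] by (simp add: t)
      have ai: "a ! i \<in> carrier G" using a True nth_mem[of i a] by auto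
      consider "generate G (set (take i a)) = carrier G" | "a ! i \<notin> generate G (set (take i a))"
        using a(1,3) i True by (auto simp: greedy_def)
      then show ?thesis
      proof cases
        case 1
        then show ?thesis using g bij by (simp add: bij_betw_imp_surj_on)
      next
        case 2
        then have "\<phi> (a ! i) \<notin> \<phi> ` generate G (set (take i a))"
          using ai G.generate_incl[OF S] bij by (metis bij_betw_imp_inj_on inj_on_image_mem_iff)
        then show ?thesis using g bi by simp
      qed
    qed
  qed
  have full: "generate H (set b) = carrier H"
    using H.greedy_generates[OF fin(3) b(2) gr] fin b(1) by simp
  have b0: "b \<noteq> []" using b(1) fin by auto
  have "length (bfs (\<otimes>\<^bsub>H\<^esub>) b t) = n"
    using H.set_bfs[OF fin(3) b0 b(2) stop] full fin(4) distinct_bfs by (metis distinct_card)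
  moreover
  \<comment> \<open>The search is transported backwards, from the given tuple of H to G.\<close>
  define \<psi> where "\<psi> = inv_into (carrier G) \<phi>"
  define x where "x = map \<psi> (drop h b)"
  have \<psi>: "\<psi> c \<in> carrier G" "\<phi> (\<psi> c) = c" if "c \<in> carrier H" for c
    using that bij unfolding \<psi>_def by (metis bij_betw_imp_surj_on inv_into_into, metis bij_betw_inv_into_right)
  have \<psi>\<phi>: "\<psi> (\<phi> c) = c" if "c \<in> carrier G" for c
    using that bij unfolding \<psi>_def by (metis bij_betw_inv_into_left)
  have "map \<psi> (take h b) = a" unfolding b(4) using a(2) \<psi>\<phi> by (simp add: map_idI subset_iff)
  then have ax: "a @ x = map \<psi> b" unfolding x_def by (metis append_take_drop_id map_append)
  have "length x = h" "set x \<subseteq> carrier G"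
    using b(1,2) \<psi> by (auto simp: x_def dest!: in_set_dropD)
  moreover
  have "bfs (\<otimes>) (map \<psi> b) t = map \<psi> (bfs (\<otimes>\<^bsub>H\<^esub>) b t) \<and>
      code n (\<otimes>) (map \<psi> b) t = code n (\<otimes>\<^bsub>H\<^esub>) b t \<and> running (\<otimes>) (map \<psi> b) t"
  proof (rule bfs_map[OF b0 b(2)])
    show "inj_on \<psi> (carrier H)" using \<psi>(2) by (metis inj_onI)
    show "\<psi> (c \<otimes>\<^bsub>H\<^esub> d) = \<psi> c \<otimes> \<psi> d" if "c \<in> carrier H" "d \<in> carrier H" for c d
      using that \<psi> \<psi>\<phi> by (metis G.m_closed \<phi>.hom_mult)
  qed (use stop in \<open>auto simp: stops_def\<close>)
  ultimately show ?thesis using stop a(1) b(1)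
    by (intro conjI exI[of _ x]) (auto simp: stops_def ax)
qed

section \<open>Counting in base n\<close>

text \<open>The least significant digit comes first, in the direction in which
  \<open>incr_prog\<close> carries.\<close>

primrec val :: "nat \<Rightarrow> nat list \<Rightarrow> nat" where
  "val n [] = 0"
| "val n (y # ys) = y + n * val n ys"

lemma val_append: "val n (xs @ ys) = val n xs + n ^ length xs * val n ys"
  by (induction xs) (simp_all add: algebra_simps)

lemma val_replicate_0: "val n (replicate j 0) = 0"
  by (induction j) simp_all

lemma val_replicate_max: "0 < n \<Longrightarrow> Suc (val n (replicate j (n - 1))) = n ^ j"
proof (induction j)
  case (Suc j)
  have "Suc (val n (replicate (Suc j) (n - 1))) = n * Suc (val n (replicate j (n - 1)))"
    using Suc.prems by simp
  then show ?case by (simp only: power_Suc Suc.IH[OF Suc.prems])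
qed simp

text \<open>One move of an odometer: leading entries \<open>n - 1\<close> turn to 0 and the next
  entry absorbs the carry.\<close>

lemma val_incr:
  assumes "0 < n"
  shows "val n (replicate j 0 @ Suc y # ys) = Suc (val n (replicate j (n - 1) @ y # ys))"
proof -
  have "val n (replicate j 0 @ Suc y # ys) = n ^ j + n ^ j * (y + n * val n ys)"
    by (simp add: val_append val_replicate_0)
  also have "\<dots> = Suc (val n (replicate j (n - 1)) + n ^ j * (y + n * val n ys))"
    using val_replicate_max[OF assms, of j] by linarith
  also have "\<dots> = Suc (val n (replicate j (n - 1) @ y # ys))"
    by (simp only: val_append length_replicate val.simps)
  finally show ?thesis .
qed

lemma val_less: "set ys \<subseteq> {0..<n} \<Longrightarrow> val n ys < n ^ length ys"
proof (induction ys)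
  case (Cons y ys)
  then have "val n ys + 1 \<le> n ^ length ys" "y < n" by auto
  then have "y + n * val n ys < n * (val n ys + 1)" by simp
  also have "\<dots> \<le> n * n ^ length ys" using \<open>val n ys + 1 \<le> n ^ length ys\<close> by (rule mult_le_mono2)
  finally show ?case by simp
qed simp

lemma val_inj:
  "length xs = length ys \<Longrightarrow> set xs \<subseteq> {0..<n} \<Longrightarrow> set ys \<subseteq> {0..<n} \<Longrightarrow> val n xs = val n ys \<Longrightarrow> xs = ys"
proof (induction xs ys rule: list_induct2)
  case (Cons x xs y ys)
  then have "x < n" "y < n" by auto
  have eq: "x + n * val n xs = y + n * val n ys" using Cons.prems(3) by simp
  have "x = (x + n * val n xs) mod n" using \<open>x < n\<close> by simp
  also have "\<dots> = y" unfolding eq using \<open>y < n\<close> by simp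
  finally have "x = y" .
  then have "val n xs = val n ys" using eq \<open>x < n\<close> by simp
  then have "xs = ys" using Cons.IH Cons.prems(1,2) by simp
  with \<open>x = y\<close> show ?case by simp
qed simp

section \<open>Subroutines\<close>

text \<open>For postconditions that bound the time, the bounds of the two parts add up. Nested sums
  such as the one in \<open>step_time\<close> have the shape that this rule produces.\<close>

lemma wp_seq:
  assumes "wp x M c (\<lambda>t s A. t \<le> a \<and> wp x M d (\<lambda>t s A. t \<le> b \<and> P s A) s A) s A"
  shows "wp x M (c ;; d) (\<lambda>t s A. t \<le> a + b \<and> P s A) s A"
  unfolding wp_basic(7) by (rule wp_mono[OF assms], elim conjE, erule wp_mono) auto

lemma wp_seq_Plus:
  assumes "s u + s w < M" "wp x M d (\<lambda>t s A. t \<le> b \<and> P s A) (s(v := s u + s w)) A"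
  shows "wp x M (Plus v u w ;; d) (\<lambda>t s A. t \<le> 1 + b \<and> P s A) s A"
  by (rule wp_seq) (use assms in \<open>simp add: wp_basic(2)\<close>)

lemma wp_seq_Const:
  assumes "k < M" "wp x M d (\<lambda>t s A. t \<le> b \<and> P s A) (s(v := k)) A"
  shows "wp x M (Const v k ;; d) (\<lambda>t s A. t \<le> 1 + b \<and> P s A) s A"
  by (rule wp_seq) (use assms in \<open>simp add: wp_basic(1)\<close>)

lemma wp_seq_Read:
  assumes "wp x M d (\<lambda>t s A. t \<le> b \<and> P s A) (s(v := A a (s i))) A"
  shows "wp x M (Read v a i ;; d) (\<lambda>t s A. t \<le> 1 + b \<and> P s A) s A"
  by (rule wp_seq) (use assms in \<open>simp add: wp_basic(4)\<close>)

section \<open>The breadth-first search as a program\<close>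

definition clear_prog :: com where
  "clear_prog = Const vV 0 ;; WhileLess vV vN (Write aIdx vV vZero ;; Plus vV vV vOne)"

text \<open>Row \<open>vU\<close> of a table starts \<open>n * vU\<close> entries after its
  beginning; for want of multiplication this offset is accumulated in \<open>vW\<close> while
  \<open>vU\<close> is used up.\<close>

definition mul_prog :: com where
  "mul_prog = WhileLess vZero vU (Plus vW vW vN ;; Minus vU vU vOne)"

definition shift_prog :: com where
  "shift_prog = Const vU 0 ;; WhileLess vU vN (Plus vCode vCode vCode ;; Plus vU vU vOne)"

text \<open>\<open>vPos\<close> and \<open>vI\<close> carry quotient and remainder of the step
  number by \<open>vK\<close>, so that no division occurs. \<open>Const vU 0\<close> stands for an
  empty branch.\<close>

definition bfs_step :: "arr \<Rightarrow> com" where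
  "bfs_step a = Read vU aLst vPos ;; Read vW a vI ;; Plus vW vW vOff ;; mul_prog ;; Input vV vW ;;
     Read vT aIdx vV ;;
     IfLess vZero vT (Const vU 0)
       (Write aLst vLen vV ;; Plus vLen vLen vOne ;; Plus vT vLen vZero ;; Write aIdx vV vT) ;;
     shift_prog ;; Plus vCode vCode vT ;; Plus vI vI vOne ;;
     IfLess vI vK (Const vU 0) (Const vI 0 ;; Plus vPos vPos vOne)"

definition bfs_prog :: "arr \<Rightarrow> com" where
  "bfs_prog a = clear_prog ;; Read vV a vZero ;; Write aLst vZero vV ;; Write aIdx vV vOne ;;
     Const vLen 1 ;; Const vCode 1 ;; Const vPos 0 ;; Const vI 0 ;; WhileLess vPos vLen (bfs_step a)"

text \<open>\<open>m\<close> is the maximal length of a tuple. A search has at most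
  \<open>n * m\<close> steps, each contributing \<open>n\<close> binary digits, whence
  \<open>M_code\<close>; \<open>M_large\<close> is for counters, input positions and, through
  \<open>4 * n\<close>, the power of two computed in \<open>init_prog\<close>.\<close>

locale bounds =
  fixes x :: "nat list" and M n m :: nat
  assumes n_pos: "0 < n" and M_code: "2 ^ (n * (n * m) + 1) \<le> M"
    and M_large: "4 * n * n + 4 * n + 2 * m + 10 < M"
begin

definition env :: "vars \<Rightarrow> bool" where
  "env s \<longleftrightarrow> s vZero = 0 \<and> s vOne = Suc 0 \<and> s vN = n"

text \<open>Only \<open>aIdx\<close> has to be reset between two searches, because
  \<open>aLst\<close> is read only below \<open>vLen\<close>.\<close>

lemma wp_clear:
  assumes "env s"
    and "\<And>\<tau> A'. \<tau> \<le> 3 * n + 2 \<Longrightarrow> \<forall>v<n. A' aIdx v = 0 \<Longrightarrow> \<forall>b. b \<noteq> aIdx \<longrightarrow> A' b = A b \<Longrightarrow>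
      P \<tau> (s(vV := n)) A'"
  shows "wp x M clear_prog P s A"
proof -
  have "wp x M (WhileLess vV vN (Write aIdx vV vZero ;; Plus vV vV vOne)) (\<lambda>t. P (1 + t)) (s(vV := 0)) A"
  proof (rule wp_while[where m = n and b = 2 and
      Inv = "\<lambda>t s' A'. t \<le> n \<and> s' = s(vV := t) \<and> (\<forall>v<t. A' aIdx v = 0) \<and> (\<forall>b. b \<noteq> aIdx \<longrightarrow> A' b = A b)"])
    fix t s' A'
    assume "t \<le> n \<and> s' = s(vV := t) \<and> (\<forall>v<t. A' aIdx v = 0) \<and> (\<forall>b. b \<noteq> aIdx \<longrightarrow> A' b = A b)" "s' vV < s' vN"
    then show "t < n \<and> wp x M (Write aIdx vV vZero ;; Plus vV vV vOne) (\<lambda>\<tau> s' A'. \<tau> \<le> 2 \<and> Suc t \<le> n \<and>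
        s' = s(vV := Suc t) \<and> (\<forall>v<Suc t. A' aIdx v = 0) \<and> (\<forall>b. b \<noteq> aIdx \<longrightarrow> A' b = A b)) s' A'"
      using assms(1) M_large by (auto simp: wp_simps env_def less_Suc_eq)
  next
    fix t s' A' \<tau>
    assume *: "t \<le> n \<and> s' = s(vV := t) \<and> (\<forall>v<t. A' aIdx v = 0) \<and> (\<forall>b. b \<noteq> aIdx \<longrightarrow> A' b = A b)"
      "\<not> s' vV < s' vN" "\<tau> \<le> n * (2 + 1) + 1"
    then have "t = n" using assms(1) by (simp add: env_def)
    then show "P (1 + \<tau>) s' A'" using * assms(2)[of "1 + \<tau>" A'] by simp
  qed simp
  then show ?thesis using M_large by (simp add: clear_prog_def wp_simps)
qed

lemma wp_mul:
  assumes "env s" "s vW + n * s vU < M"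
    and "\<And>\<tau>. \<tau> \<le> 3 * s vU + 1 \<Longrightarrow> P \<tau> (s(vW := s vW + n * s vU, vU := 0)) A"
  shows "wp x M mul_prog P s A"
  unfolding mul_prog_def
proof (rule wp_while[where m = "s vU" and b = 2 and
    Inv = "\<lambda>t s' A'. t \<le> s vU \<and> s' = s(vW := s vW + n * t, vU := s vU - t) \<and> A' = A"])
  show "0 \<le> s vU \<and> s = s(vW := s vW + n * 0, vU := s vU - 0) \<and> A = A" by simp
next
  fix t s' A'
  assume *: "t \<le> s vU \<and> s' = s(vW := s vW + n * t, vU := s vU - t) \<and> A' = A" "s' vZero < s' vU"
  then have t: "t < s vU" using assms(1) by (simp add: env_def)
  then have "n * Suc t \<le> n * s vU" by (intro mult_le_mono2) simp
  then have "s vW + n * t + n < M" using assms(2) by (simp add: mult_Suc_right)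
  with * t show "t < s vU \<and> wp x M (Plus vW vW vN ;; Minus vU vU vOne) (\<lambda>\<tau> s' A'. \<tau> \<le> 2 \<and> Suc t \<le> s vU \<and>
      s' = s(vW := s vW + n * Suc t, vU := s vU - Suc t) \<and> A' = A) s' A'"
    using assms(1) by (auto simp: wp_simps env_def fun_eq_iff)
next
  fix t s' A' \<tau>
  assume *: "t \<le> s vU \<and> s' = s(vW := s vW + n * t, vU := s vU - t) \<and> A' = A"
    "\<not> s' vZero < s' vU" "\<tau> \<le> s vU * (2 + 1) + 1"
  then have "t = s vU" using assms(1) by (simp add: env_def)
  then show "P \<tau> s' A'" using * assms(3)[of \<tau>] by simp
qed

lemma wp_shift:
  assumes "env s" "s vCode * 2 ^ n < M"
    and "\<And>\<tau>. \<tau> \<le> 3 * n + 2 \<Longrightarrow> P \<tau> (s(vU := n, vCode := s vCode * 2 ^ n)) A"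
  shows "wp x M shift_prog P s A"
proof -
  have "wp x M (WhileLess vU vN (Plus vCode vCode vCode ;; Plus vU vU vOne)) (\<lambda>t. P (1 + t)) (s(vU := 0)) A"
  proof (rule wp_while[where m = n and b = 2 and
      Inv = "\<lambda>t s' A'. t \<le> n \<and> s' = s(vU := t, vCode := s vCode * 2 ^ t) \<and> A' = A"])
    show "0 \<le> n \<and> s(vU := 0) = s(vU := 0, vCode := s vCode * 2 ^ 0) \<and> A = A" by (simp add: fun_eq_iff)
  next
    fix t s' A'
    assume *: "t \<le> n \<and> s' = s(vU := t, vCode := s vCode * 2 ^ t) \<and> A' = A" "s' vU < s' vN"
    then have t: "t < n" using assms(1) by (simp add: env_def)
    then have "s vCode * 2 ^ t * 2 \<le> s vCode * 2 ^ n" using power_increasing[of "Suc t" n "2::nat"] by (simp add: mult.assoc mult.commute)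
    then have "s vCode * 2 ^ t + s vCode * 2 ^ t < M" using assms(2) by linarith
    with * t show "t < n \<and> wp x M (Plus vCode vCode vCode ;; Plus vU vU vOne) (\<lambda>\<tau> s' A'. \<tau> \<le> 2 \<and>
        Suc t \<le> n \<and> s' = s(vU := Suc t, vCode := s vCode * 2 ^ Suc t) \<and> A' = A) s' A'"
      using assms(1) M_large by (auto simp: wp_simps env_def fun_eq_iff)
  next
    fix t s' A' \<tau>
    assume *: "t \<le> n \<and> s' = s(vU := t, vCode := s vCode * 2 ^ t) \<and> A' = A"
      "\<not> s' vU < s' vN" "\<tau> \<le> n * (2 + 1) + 1"
    then have "t = n" using assms(1) by (simp add: env_def)
    then show "P (1 + \<tau>) s' A'" using * assms(3)[of "1 + \<tau>"] by simp
  qed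
  then show ?thesis using M_large by (simp add: shift_prog_def wp_simps)
qed

text \<open>\<open>l\<close> is where the table starts in the input, either 1 or
  \<open>n * n + 1\<close>; the position is written in the order in which \<open>bfs_step\<close>
  adds it up.\<close>

definition table :: "nat \<Rightarrow> (nat \<Rightarrow> nat \<Rightarrow> nat) \<Rightarrow> bool" where
  "table l f \<longleftrightarrow> l \<le> n * n + 1 \<and> (\<forall>u<n. \<forall>w<n. input_at x (w + l + n * u) = f u w \<and> f u w < n)"

text \<open>At most \<open>n * m\<close> iterations, each with at most \<open>6 * n + 21\<close>
  steps for the body and one for the test; the remaining terms cover clearing and setting
  up.\<close>

definition bfs_time :: nat where
  "bfs_time = n * m * (6 * n + 22) + 3 * n + 12"

definition bfs_frame :: "vars \<Rightarrow> arrs \<Rightarrow> vars \<Rightarrow> arrs \<Rightarrow> bool" where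
  "bfs_frame s A s' A' \<longleftrightarrow>
     (\<forall>v. v \<notin> {vV, vLen, vCode, vPos, vI, vU, vW, vT} \<longrightarrow> s' v = s v) \<and>
     (\<forall>b. b \<notin> {aLst, aIdx} \<longrightarrow> A' b = A b)"

text \<open>Beyond the current list the content of \<open>aLst\<close> is left open, since an
  earlier search may have written there.\<close>

definition bfs_inv :: "(nat \<Rightarrow> nat \<Rightarrow> nat) \<Rightarrow> nat list \<Rightarrow> vars \<Rightarrow> arrs \<Rightarrow> nat \<Rightarrow> vars \<Rightarrow> arrs \<Rightarrow> bool" where
  "bfs_inv f g s A t s' A' \<longleftrightarrow> running f g t \<and> s' vPos = t div length g \<and> s' vI = t mod length g \<and>
     s' vLen = length (bfs f g t) \<and> s' vCode = code n f g t \<and>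
     (\<forall>j<length (bfs f g t). A' aLst j = bfs f g t ! j) \<and>
     (\<forall>v<n. A' aIdx v = (if v \<in> set (bfs f g t) then label (bfs f g t) v else 0)) \<and>
     bfs_frame s A s' A'"

lemma wp_bfs_step:
  assumes inv: "bfs_inv f g s A t s' A'" and lt: "s' vPos < s' vLen"
    and s: "env s" "s vOff = l" "table l f" "s vK = length g"
    and g: "g = map (A a) [0..<length g]" "set g \<subseteq> {0..<n}" "0 < length g" "length g \<le> m"
    and a: "a = aGA \<or> a = aGB"
  shows "t < n * m \<and> wp x M (bfs_step a) (\<lambda>\<tau> s' A'. \<tau> \<le> 6 * n + 21 \<and> bfs_inv f g s A (Suc t) s' A') s' A'"
proof -
  let ?k = "length g" and ?L = "bfs f g t" and ?v = "visit f g t"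
  note inv' = inv[unfolded bfs_inv_def]
  have fr: "s' v = s v" if "v \<notin> {vV, vLen, vCode, vPos, vI, vU, vW, vT}" for v
    using inv' that by (auto simp: bfs_frame_def)
  have frA: "A' b = A b" if "b \<notin> {aLst, aIdx}" for b
    using inv' that by (auto simp: bfs_frame_def)
  have g0: "g \<noteq> []" using g(3) by auto
  have run: "running f g t" using inv' by simp
  have tk: "t < ?k * length ?L" using lt inv' g(3) by (simp add: div_less_iff_less_mult mult.commute)
  have run': "running f g (Suc t)" using run tk by (auto simp: running_def less_Suc_eq)
  have cl: "f u w \<in> {0..<n}" if "u \<in> {0..<n}" "w \<in> {0..<n}" for u w
    using that s(3) by (auto simp: table_def)
  have L: "set ?L \<subseteq> {0..<n}" and L': "set (bfs f g (Suc t)) \<subseteq> {0..<n}"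
    using bfs_subset[OF g0 g(2) cl run] bfs_subset[OF g0 g(2) cl run'] by auto
  have len: "length ?L \<le> n" "length (bfs f g (Suc t)) \<le> n"
    using L L' card_mono[of "{0..<n}"] distinct_card[OF distinct_bfs] by (metis card_atLeastLessThan diff_zero finite_atLeastLessThan)+
  have "?k * length ?L \<le> m * n" using g(4) len by (intro mult_le_mono)
  then have tm: "t < n * m" using tk by (simp add: mult.commute)
  have ix: "t div ?k < length ?L" "t mod ?k < ?k" using visit_index[OF tk] by auto
  define u where "u = ?L ! (t div ?k)"
  define w where "w = g ! (t mod ?k)"
  have u: "u < n" using L nth_mem[OF ix(1)] by (auto simp: u_def)
  have w: "w < n" using g(2) nth_mem[OF ix(2)] by (auto simp: w_def)
  have v: "?v = f u w" by (simp add: visit_def u_def w_def)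
  have vn: "?v < n" using cl[of u w] u w v by simp
  have ru: "A' aLst (s' vPos) = u" using inv' ix by (simp add: u_def)
  have rw: "A' a (s' vI) = w"
  proof -
    have "A' a = A a" using frA[of a] a by auto
    moreover have "map (A a) [0..<?k] ! (t mod ?k) = A a (t mod ?k)" using ix by simp
    ultimately show ?thesis using inv' g(1) by (simp add: w_def)
  qed
  have nu: "n * u + n \<le> n * n" using u by (metis Suc_leI mult_Suc_right mult_le_mono2 add.commute)
  have l: "l \<le> n * n + 1" and input: "input_at x (w + l + n * u) = ?v"
    using s(3) u w v by (auto simp: table_def)
  have M1: "w + l < M" "w + l + n * u < M" using l w nu M_large by auto
  have d: "digit f g s < 2 ^ n" if "s < Suc t" for s
  proof -
    have "running f g (Suc s)" using run' that by (auto simp: running_def)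
    from digit_le[OF _ _ bfs_subset[OF g0 g(2) cl this], of n] show ?thesis
      using less_exp[of n] by (simp add: le_less_trans)
  qed
  \<comment> \<open>Here \<open>M_code\<close> is needed: \<open>t\<close> is below
    \<open>n * m\<close>, so the new code has at most \<open>n * (n * m) + 1\<close> binary
    digits.\<close>
  have "code n f g (Suc t) < 2 ^ (n * Suc t + 1)" using d by (rule code_less)
  also have "\<dots> \<le> 2 ^ (n * (n * m) + 1)"
    using tm by (intro power_increasing add_mono mult_le_mono) auto
  finally have cM: "code n f g (Suc t) < M" using M_code by simp
  then have cM': "code n f g t * 2 ^ n + digit f g t < M" by simp
  have idx: "A' aIdx ?v = (if ?v \<in> set ?L then label ?L ?v else 0)" using inv' vn by auto
  have dg: "digit f g t = (if ?v \<in> set ?L then label ?L ?v else Suc (length ?L))"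
    by (simp add: digit_def bfs_Suc label_snoc)
  have step: "(if Suc (t mod ?k) < ?k then Suc t div ?k = t div ?k \<and> Suc t mod ?k = Suc (t mod ?k)
      else Suc t div ?k = Suc (t div ?k) \<and> Suc t mod ?k = 0)"
    using ix(2) by (auto simp: div_Suc mod_Suc)
  have lM: "Suc (length ?L) < M" "Suc (t mod ?k) < M" "Suc (t div ?k) < M"
    using len ix g(4) M_large by auto
  have env': "s' vZero = 0" "s' vOne = Suc 0" "s' vN = n" "s' vOff = l" "s' vK = ?k"
    using fr[of vZero] fr[of vOne] fr[of vN] fr[of vOff] fr[of vK] s by (auto simp: env_def)
  let ?tail = "shift_prog ;; Plus vCode vCode vT ;; Plus vI vI vOne ;;
     IfLess vI vK (Const vU 0) (Const vI 0 ;; Plus vPos vPos vOne)"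
  \<comment> \<open>The branches for a known and for a new element end with the same commands, which
    are treated once for any state with the list already updated and the digit in
    \<open>vT\<close>.\<close>
  have tail: "wp x M ?tail (\<lambda>\<tau> s' A'. \<tau> \<le> 3 * n + 7 \<and> bfs_inv f g s A (Suc t) s' A') s2 A2"
    if "bfs_frame s A s2 A2" "s2 vT = digit f g t" "s2 vCode = code n f g t" "s2 vPos = t div ?k"
      "s2 vI = t mod ?k" "s2 vLen = length (bfs f g (Suc t))"
      "\<forall>j<length (bfs f g (Suc t)). A2 aLst j = bfs f g (Suc t) ! j"
      "\<forall>v<n. A2 aIdx v = (if v \<in> set (bfs f g (Suc t)) then label (bfs f g (Suc t)) v else 0)" for s2 A2
  proof -
    have e: "s2 vZero = 0" "s2 vOne = Suc 0" "s2 vN = n" "s2 vK = ?k"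
      using that(1) s by (auto simp: bfs_frame_def env_def)
    show ?thesis
      apply (simp only: wp_basic(7))
      apply (rule wp_shift)
      subgoal by (simp add: e env_def)
      subgoal using cM' by (simp add: that)
      subgoal using step lM cM' that M_large
        by (auto simp: wp_simps e bfs_inv_def run' bfs_frame_def split: if_splits)
      done
  qed
  have "wp x M (bfs_step a) (\<lambda>\<tau> s' A'. \<tau> \<le> 6 * n + 21 \<and> bfs_inv f g s A (Suc t) s' A') s' A'"
    unfolding bfs_step_def
    apply (simp add: wp_if wp_basic(1-6) wp_basic(7)[where c = "Read _ _ _"] wp_basic(7)[where c = "Plus _ _ _"]
      wp_basic(7)[where c = "mul_prog"] env' ru rw M1)
    apply (rule wp_mul)
    subgoal by (simp add: env_def env')
    subgoal by (simp add: M1)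
    subgoal premises p for \<tau>
    proof (cases "?v \<in> set ?L")
      case True
      then have "0 < label ?L ?v" by (simp add: label_def)
      with True p u M_large show ?thesis
        apply (simp add: wp_if wp_basic(1-6) wp_basic(7)[where c = "Read _ _ _"] wp_basic(7)[where c = "Input _ _"]
          wp_basic(7)[where c = "IfLess _ _ _ _"] env' input idx)
        apply (rule wp_mono[OF tail])
        using inv' dg by (auto simp: bfs_frame_def bfs_Suc)
    next
      case False
      with p u M_large lM show ?thesis
        apply (simp add: wp_if wp_basic(1-6) wp_basic(7)[where c = "Read _ _ _"] wp_basic(7)[where c = "Input _ _"]
          wp_basic(7)[where c = "IfLess _ _ _ _"] wp_basic(7)[where c = "Write _ _ _"] wp_basic(7)[where c = "Plus _ _ _"]
          env' input idx inv')
        apply (rule wp_mono[OF tail])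
        using inv' dg vn False
        by (auto simp: bfs_frame_def bfs_Suc nth_append less_Suc_eq label_snoc label_append)
    qed
    done
  with tm show ?thesis by simp
qed

lemma wp_bfs:
  assumes s: "env s" "s vOff = l" "table l f" "s vK = k"
    and g: "\<And>i. i < k \<Longrightarrow> A a i < n" "0 < k" "k \<le> m" and a: "a = aGA \<or> a = aGB"
    and post: "\<And>\<tau> s' A' t. \<tau> \<le> bfs_time \<Longrightarrow> stops f (map (A a) [0..<k]) t \<Longrightarrow>
      s' vLen = length (bfs f (map (A a) [0..<k]) t) \<Longrightarrow> s' vCode = code n f (map (A a) [0..<k]) t \<Longrightarrow>
      \<forall>v<n. A' aIdx v = 0 \<longleftrightarrow> v \<notin> set (bfs f (map (A a) [0..<k]) t) \<Longrightarrow> bfs_frame s A s' A' \<Longrightarrow> P \<tau> s' A'"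
  shows "wp x M (bfs_prog a) P s A"
proof -
  define g where "g = map (A a) [0..<k]"
  have len: "length g = k" by (simp add: g_def)
  have gs: "g = map (A a) [0..<length g]" "set g \<subseteq> {0..<n}" "0 < length g" "length g \<le> m" "s vK = length g"
    using g(1-3) s(4) by (auto simp: g_def)
  then have g0: "g \<noteq> []" by auto
  \<comment> \<open>\<open>c\<close> stands for the time spent before the loop: at most
    \<open>3 * n + 2\<close> for clearing, plus seven commands.\<close>
  have loop: "wp x M (WhileLess vPos vLen (bfs_step a)) (\<lambda>\<tau> s' A'. \<forall>c\<le>3 * n + 9. P (c + \<tau>) s' A') s1 A1"
    if "bfs_inv f g s A 0 s1 A1" for s1 A1
  proof (rule wp_while[where m = "n * m" and b = "6 * n + 21" and Inv = "bfs_inv f g s A", OF that(1)])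
    show "t < n * m \<and> wp x M (bfs_step a) (\<lambda>\<tau> s' A'. \<tau> \<le> 6 * n + 21 \<and> bfs_inv f g s A (Suc t) s' A') s' A'"
      if "bfs_inv f g s A t s' A'" "s' vPos < s' vLen" for t s' A'
      by (rule wp_bfs_step[OF that s(1-3) gs(5,1-4) a])
    show "\<forall>c\<le>3 * n + 9. P (c + \<tau>) s' A'" if *: "bfs_inv f g s A t s' A'" "\<not> s' vPos < s' vLen"
      "\<tau> \<le> n * m * (6 * n + 21 + 1) + 1" for t s' A' \<tau>
    proof (intro allI impI)
      fix c assume "c \<le> 3 * n + 9"
      have "stops f g t" using * g0 by (intro stops_if_not_less) (auto simp: bfs_inv_def)
      moreover have "c + \<tau> \<le> bfs_time" using *(3) \<open>c \<le> _\<close> by (simp add: bfs_time_def algebra_simps)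
      ultimately show "P (c + \<tau>) s' A'" using *(1) post[folded g_def, of "c + \<tau>" t s' A']
        by (auto simp: bfs_inv_def label_def)
    qed
  qed
  have A0: "A a 0 < n" using g by simp
  show ?thesis
    unfolding bfs_prog_def
    apply (simp only: wp_basic(7)[where c = clear_prog])
    apply (rule wp_clear[OF s(1)])
    subgoal premises p for \<tau> A'
    proof -
      have "A' a = A a" using p(3) a by auto
      moreover have "g ! 0 = A a 0" using g(2) by (simp add: g_def)
      ultimately show ?thesis
      using p s(1) M_large A0 g(2)
      apply (simp add: wp_basic env_def)
      apply (rule wp_mono[OF loop])
      subgoal by (auto simp: bfs_inv_def running_def bfs_frame_def label_def len)
      subgoal for t by (drule spec[of _ "Suc (Suc (Suc (Suc (Suc (Suc (Suc \<tau>))))))"]) simp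
      done
    qed
    done
qed

end

section \<open>Greedy completion and enumeration of tuples\<close>

definition scan_prog :: com where
  "scan_prog = Const vJ 0 ;; Const vV 0 ;; WhileLess vV vN (Read vT aIdx vV ;;
     IfLess vZero vT (Const vU 0) (Plus vJ vV vZero) ;; Plus vV vV vOne)"

definition complete_prog :: "arr \<Rightarrow> com" where
  "complete_prog a = WhileLess vK vHi (bfs_prog a ;; scan_prog ;; Write a vK vJ ;; Plus vK vK vOne)"

text \<open>Setting \<open>vI\<close> to \<open>vHi\<close> leaves the loop once the carry is
  absorbed. \<open>vF\<close> stays 0 exactly if the carry runs off the end, which terminates the
  enumeration.\<close>

definition incr_prog :: "arr \<Rightarrow> com" where
  "incr_prog a = Plus vI vLo vZero ;; Const vF 0 ;;
     WhileLess vI vHi (Read vT a vI ;; Plus vT vT vOne ;;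
       IfLess vT vN (Write a vI vT ;; Const vF 1 ;; Plus vI vHi vZero)
         (Write a vI vZero ;; Plus vI vI vOne))"

context bounds
begin

text \<open>The last unvisited element survives in \<open>vJ\<close>. If there is none,
  \<open>vJ\<close> keeps the default 0, still a valid element.\<close>

lemma wp_scan:
  assumes "env s"
    and "\<And>\<tau> s'. \<tau> \<le> 5 * n + 3 \<Longrightarrow> s' vJ < n \<Longrightarrow> (\<exists>v<n. A aIdx v = 0) \<longrightarrow> A aIdx (s' vJ) = 0 \<Longrightarrow>
      \<forall>v. v \<notin> {vJ, vV, vT, vU} \<longrightarrow> s' v = s v \<Longrightarrow> P \<tau> s' A"
  shows "wp x M scan_prog P s A"
proof -
  define Inv where "Inv t s' A' \<longleftrightarrow> t \<le> n \<and> s' vV = t \<and> A' = A \<and> s' vJ < n \<and>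
    ((\<exists>v<t. A aIdx v = 0) \<longrightarrow> A aIdx (s' vJ) = 0) \<and> (\<forall>v. v \<notin> {vJ, vV, vT, vU} \<longrightarrow> s' v = s v)"
    for t and s' :: vars and A'
  have "wp x M (WhileLess vV vN (Read vT aIdx vV ;;
     IfLess vZero vT (Const vU 0) (Plus vJ vV vZero) ;; Plus vV vV vOne)) (\<lambda>t. P (Suc (Suc t))) (s(vJ := 0, vV := 0)) A"
  proof (rule wp_while[where m = n and b = 4 and Inv = Inv])
    show "Inv 0 (s(vJ := 0, vV := 0)) A" using n_pos by (simp add: Inv_def)
  next
    fix t s' A' assume *: "Inv t s' A'" "s' vV < s' vN"
    have e: "s' vZero = 0" "s' vOne = Suc 0" "s' vN = n" using * assms(1) by (auto simp: Inv_def env_def)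
    with * show "t < n \<and> wp x M (Read vT aIdx vV ;; IfLess vZero vT (Const vU 0) (Plus vJ vV vZero) ;;
        Plus vV vV vOne) (\<lambda>\<tau> s A. \<tau> \<le> 4 \<and> Inv (Suc t) s A) s' A'"
      using M_large by (auto simp: wp_simps Inv_def less_Suc_eq)
  next
    fix t s' A' \<tau> assume *: "Inv t s' A'" "\<not> s' vV < s' vN" "\<tau> \<le> n * (4 + 1) + 1"
    have e: "s' vN = n" using * assms(1) by (auto simp: Inv_def env_def)
    with * have "t = n" by (simp add: Inv_def)
    then show "P (Suc (Suc \<tau>)) s' A'" using * assms(2)[of "Suc (Suc \<tau>)" s'] by (auto simp: Inv_def)
  qed
  then show ?thesis using M_large by (simp add: scan_prog_def wp_basic)
qed

definition complete_time :: nat where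
  "complete_time = m * (bfs_time + 5 * n + 6) + 1"

definition complete_frame :: "arr \<Rightarrow> vars \<Rightarrow> arrs \<Rightarrow> vars \<Rightarrow> arrs \<Rightarrow> bool" where
  "complete_frame a s A s' A' \<longleftrightarrow>
     (\<forall>v. v \<notin> {vV, vLen, vCode, vPos, vI, vU, vW, vT, vJ, vK} \<longrightarrow> s' v = s v) \<and>
     (\<forall>b. b \<notin> {a, aLst, aIdx} \<longrightarrow> A' b = A b)"

text \<open>In a group the visited elements form the generated subgroup, so the entry found by
  \<open>scan_prog\<close> lies outside of it unless the subgroup is already everything.\<close>

lemma wp_complete:
  assumes s: "env s" "s vOff = l" "table l (mult G)" "s vK = k" "s vHi = hi"
    and G: "group G" "carrier G = {0..<n}"
    and g: "\<And>i. i < k \<Longrightarrow> A a i < n" "0 < k" "k \<le> hi" "hi \<le> m" and a: "a = aGA \<or> a = aGB"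
    and post: "\<And>\<tau> s' A'. \<tau> \<le> complete_time \<Longrightarrow> s' vK = hi \<Longrightarrow> \<forall>i. i < k \<or> hi \<le> i \<longrightarrow> A' a i = A a i \<Longrightarrow>
      \<forall>i<hi. A' a i < n \<Longrightarrow> greedy G k (map (A' a) [0..<hi]) \<Longrightarrow> complete_frame a s A s' A' \<Longrightarrow> P \<tau> s' A'"
  shows "wp x M (complete_prog a) P s A"
proof -
  define Inv where "Inv t s' A' \<longleftrightarrow> k + t \<le> hi \<and> s' vK = k + t \<and> (\<forall>i. i < k \<or> k + t \<le> i \<longrightarrow> A' a i = A a i) \<and>
    (\<forall>i<k + t. A' a i < n) \<and> greedy G k (map (A' a) [0..<k + t]) \<and> complete_frame a s A s' A'"
    for t s' A'
  show ?thesis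
    unfolding complete_prog_def
  proof (rule wp_while[where m = m and b = "bfs_time + 5 * n + 5" and Inv = Inv])
    show "Inv 0 s A" using s g by (auto simp: Inv_def complete_frame_def greedy_def)
  next
    fix t s' A' \<tau> assume *: "Inv t s' A'" "\<not> s' vK < s' vHi" "\<tau> \<le> m * (bfs_time + 5 * n + 5 + 1) + 1"
    then have "s' vHi = hi" using s by (auto simp: Inv_def complete_frame_def)
    with * have "k + t = hi" by (simp add: Inv_def)
    moreover have "\<tau> \<le> complete_time" using *(3) by (simp add: complete_time_def algebra_simps)
    ultimately show "P \<tau> s' A'" using *(1) post[of \<tau> s' A'] by (simp add: Inv_def)
  next
    fix t s' A' assume *: "Inv t s' A'" "s' vK < s' vHi"
    have e: "env s'" "s' vOff = l" "s' vHi = hi" "s' vK = k + t"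
      using *(1) s by (auto simp: Inv_def complete_frame_def env_def)
    have lt: "k + t < hi" using e * by simp
    let ?g = "map (A' a) [0..<k + t]"
    have g': "\<And>i. i < k + t \<Longrightarrow> A' a i < n" using * by (simp add: Inv_def)
    interpret group G by fact
    have "wp x M (bfs_prog a ;; scan_prog ;; Write a vK vJ ;; Plus vK vK vOne)
       (\<lambda>\<tau> s A. \<tau> \<le> bfs_time + 5 * n + 5 \<and> Inv (Suc t) s A) s' A'"
      unfolding wp_basic(7)
    proof (rule wp_bfs[where A = A' and a = a, OF e(1,2) s(3) e(4) g' _ _ a])
      show "0 < k + t" "k + t \<le> m" using lt g by auto
    next
      fix \<tau> s1 A1 t'
      assume b: "\<tau> \<le> bfs_time" "stops (\<otimes>\<^bsub>G\<^esub>) ?g t'"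
        "\<forall>v<n. (A1 aIdx v = 0) = (v \<notin> set (bfs (\<otimes>\<^bsub>G\<^esub>) ?g t'))" "bfs_frame s' A' s1 A1"
      have "set (bfs (\<otimes>\<^bsub>G\<^esub>) ?g t') = generate G (set ?g)"
        using b(2) g' g(2) G(2) by (intro set_bfs) auto
      with b(3) have ix: "\<forall>v<n. (A1 aIdx v = 0) = (v \<notin> generate G (set ?g))" by simp
      have e1: "env s1" "s1 vK = k + t" using b(4) e by (auto simp: bfs_frame_def env_def)
      show "wp x M scan_prog (\<lambda>\<tau>'. wp x M (Write a vK vJ) (\<lambda>\<tau>''. wp x M (Plus vK vK vOne)
        (\<lambda>\<upsilon> s A. \<tau> + (\<tau>' + (\<tau>'' + \<upsilon>)) \<le> bfs_time + 5 * n + 5 \<and> Inv (Suc t) s A))) s1 A1"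
      proof (rule wp_scan[OF e1(1)])
        fix \<tau>' s2
        assume c: "\<tau>' \<le> 5 * n + 3" "s2 vJ < n" "(\<exists>v<n. A1 aIdx v = 0) \<longrightarrow> A1 aIdx (s2 vJ) = 0"
          "\<forall>v. v \<notin> {vJ, vV, vT, vU} \<longrightarrow> s2 v = s1 v"
        have e2: "s2 vOne = Suc 0" "s2 vK = k + t" using c(4) e1 by (auto simp: env_def)
        have A1: "A1 a = A' a" using b(4) a by (auto simp: bfs_frame_def)
        have gr: "generate G (set ?g) = carrier G \<or> s2 vJ \<notin> generate G (set ?g)"
        proof (cases "\<exists>v<n. A1 aIdx v = 0")
          case True
          then show ?thesis using c(2,3) ix by blast
        next
          case False
          have "set ?g \<subseteq> carrier G" using g' G(2) by auto
          moreover have "carrier G \<subseteq> generate G (set ?g)" unfolding G(2)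
            using False ix by (meson atLeastLessThan_iff subsetI)
          ultimately show ?thesis using generate_incl by blast
        qed
        let ?A = "A1(a := (A1 a)(k + t := s2 vJ))"
        have "map (?A a) [0..<k + Suc t] = ?g @ [s2 vJ]" by (simp add: A1)
        moreover have "greedy G k ?g" using *(1) by (simp add: Inv_def)
        ultimately have gr': "greedy G k (map (?A a) [0..<k + Suc t])"
          using gr by (simp only: greedy_snoc) simp
        have "complete_frame a s A (s2(vK := Suc (k + t))) ?A"
          using *(1) b(4) c(4) by (auto simp: Inv_def complete_frame_def bfs_frame_def)
        then have "Inv (Suc t) (s2(vK := Suc (k + t))) ?A"
          using *(1) gr' lt c(2) by (auto simp: Inv_def A1 less_Suc_eq)
        then show "wp x M (Write a vK vJ) (\<lambda>\<tau>''. wp x M (Plus vK vK vOne)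
            (\<lambda>\<upsilon> s A. \<tau> + (\<tau>' + (\<tau>'' + \<upsilon>)) \<le> bfs_time + 5 * n + 5 \<and> Inv (Suc t) s A)) s2 A1"
          using b(1) c(1) e2 lt g M_large by (simp add: wp_basic)
      qed
    qed
    moreover have "t < m" using lt g by simp
    ultimately show "t < m \<and> wp x M (bfs_prog a ;; scan_prog ;; Write a vK vJ ;; Plus vK vK vOne)
       (\<lambda>\<tau> s A. \<tau> \<le> bfs_time + 5 * n + 5 \<and> Inv (Suc t) s A) s' A'" by simp
  qed
qed

lemma wp_incr:
  assumes s: "env s" "s vLo = lo" "s vHi = hi" "lo \<le> hi" "hi \<le> m"
    and g: "\<And>i. lo \<le> i \<Longrightarrow> i < hi \<Longrightarrow> A a i < n"
    and post: "\<And>\<tau> s' A'. \<tau> \<le> 7 * m + 3 \<Longrightarrow>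
      s' vF = 1 \<and> val n (map (A' a) [lo..<hi]) = Suc (val n (map (A a) [lo..<hi])) \<or>
      s' vF = 0 \<and> Suc (val n (map (A a) [lo..<hi])) = n ^ (hi - lo) \<Longrightarrow>
      \<forall>i. lo \<le> i \<and> i < hi \<longrightarrow> A' a i < n \<Longrightarrow> \<forall>i. i < lo \<or> hi \<le> i \<longrightarrow> A' a i = A a i \<Longrightarrow>
      \<forall>v. v \<notin> {vI, vF, vT} \<longrightarrow> s' v = s v \<Longrightarrow> \<forall>b. b \<noteq> a \<longrightarrow> A' b = A b \<Longrightarrow> P \<tau> s' A'"
  shows "wp x M (incr_prog a) P s A"
proof -
  \<comment> \<open>The array after a carry has turned all entries from \<open>lo\<close> up to, but
    excluding, \<open>j\<close> to 0.\<close>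
  define zeros where "zeros j = (\<lambda>i. if lo \<le> i \<and> i < j then 0 else A a i)" for j
  \<comment> \<open>Two phases: the carry has arrived at \<open>lo + t\<close>, or it was absorbed
    at some \<open>j\<close> and the loop is about to end.\<close>
  define Inv where "Inv t s' A' \<longleftrightarrow>
    (s' vF = 0 \<and> s' vI = lo + t \<and> lo + t \<le> hi \<and> (\<forall>i. lo \<le> i \<and> i < lo + t \<longrightarrow> A a i = n - 1) \<and> A' a = zeros (lo + t) \<or>
     s' vF = 1 \<and> s' vI = hi \<and> (\<exists>j. lo \<le> j \<and> j < hi \<and> Suc (A a j) < n \<and>
       (\<forall>i. lo \<le> i \<and> i < j \<longrightarrow> A a i = n - 1) \<and> A' a = (zeros j)(j := Suc (A a j)))) \<and>
    (\<forall>v. v \<notin> {vI, vF, vT} \<longrightarrow> s' v = s v) \<and> (\<forall>b. b \<noteq> a \<longrightarrow> A' b = A b)" for t s' A'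
  have rep: "map (A a) [lo..<j] = replicate (j - lo) (n - 1)" if "\<forall>i. lo \<le> i \<and> i < j \<longrightarrow> A a i = n - 1" for j
    using that by (intro nth_equalityI) auto
  let ?body = "Read vT a vI ;; Plus vT vT vOne ;;
       IfLess vT vN (Write a vI vT ;; Const vF 1 ;; Plus vI vHi vZero)
         (Write a vI vZero ;; Plus vI vI vOne)"
  have "wp x M (WhileLess vI vHi ?body) (\<lambda>t. P (Suc (Suc t))) (s(vI := lo, vF := 0)) A"
  proof (rule wp_while[where m = m and b = 6 and Inv = Inv])
    show "Inv 0 (s(vI := lo, vF := 0)) A" using s by (auto simp: Inv_def zeros_def)
  next
    fix t s' A' assume *: "Inv t s' A'" "s' vI < s' vHi"
    have e: "s' vZero = 0" "s' vOne = Suc 0" "s' vN = n" "s' vHi = hi"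
      using * s by (auto simp: Inv_def env_def)
    have i: "s' vF = 0" "s' vI = lo + t" "lo + t < hi" "\<forall>i. lo \<le> i \<and> i < lo + t \<longrightarrow> A a i = n - 1"
      "A' a = zeros (lo + t)" using * e by (auto simp: Inv_def)
    have fr: "\<forall>v. v \<notin> {vI, vF, vT} \<longrightarrow> s' v = s v" "\<forall>b. b \<noteq> a \<longrightarrow> A' b = A b"
      using * by (auto simp: Inv_def)
    have A': "zeros (lo + t) (lo + t) = A a (lo + t)" by (simp add: zeros_def)
    have lt: "A a (lo + t) < n" using g i by simp
    have "wp x M ?body (\<lambda>\<tau> s A. \<tau> \<le> 6 \<and> Inv (Suc t) s A) s' A'"
    proof (cases "Suc (A a (lo + t)) < n")
      case True
      have "Inv (Suc t) (s'(vT := Suc (A a (lo + t)), vF := 1, vI := hi)) (A'(a := (A' a)(lo + t := Suc (A a (lo + t)))))"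
        using i fr True by (auto simp: Inv_def intro!: exI[of _ "lo + t"])
      then show ?thesis using True lt M_large s by (simp add: wp_simps e i A')
    next
      case False
      then have last: "A a (lo + t) = n - 1" using lt by simp
      have "zeros (lo + Suc t) = (zeros (lo + t))(lo + t := 0)" by (auto simp: zeros_def fun_eq_iff)
      then have "Inv (Suc t) (s'(vT := Suc (A a (lo + t)), vI := lo + Suc t)) (A'(a := (A' a)(lo + t := 0)))"
        using i fr last by (auto simp: Inv_def less_Suc_eq)
      moreover have "Suc (lo + t) < M" using i(3) s M_large by simp
      ultimately show ?thesis using False lt M_large s by (simp add: wp_simps e i A')
    qed
    then show "t < m \<and> wp x M ?body (\<lambda>\<tau> s A. \<tau> \<le> 6 \<and> Inv (Suc t) s A) s' A'" using i s by simp
  next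
    fix t s' A' \<tau> assume *: "Inv t s' A'" "\<not> s' vI < s' vHi" "\<tau> \<le> m * (6 + 1) + 1"
    have hi: "s' vHi = hi" using * s by (auto simp: Inv_def)
    have fr: "\<forall>v. v \<notin> {vI, vF, vT} \<longrightarrow> s' v = s v" "\<forall>b. b \<noteq> a \<longrightarrow> A' b = A b"
      using * by (auto simp: Inv_def)
    from * hi consider
      "s' vF = 0" "\<forall>i. lo \<le> i \<and> i < hi \<longrightarrow> A a i = n - 1" "A' a = zeros hi" |
      j where "s' vF = 1" "lo \<le> j" "j < hi" "Suc (A a j) < n" "\<forall>i. lo \<le> i \<and> i < j \<longrightarrow> A a i = n - 1"
        "A' a = (zeros j)(j := Suc (A a j))"
      by (auto simp: Inv_def le_antisym not_less)
    then show "P (Suc (Suc \<tau>)) s' A'"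
    proof cases
      case 1
      have "Suc (val n (map (A a) [lo..<hi])) = n ^ (hi - lo)"
        unfolding rep[OF 1(2)] by (rule val_replicate_max[OF n_pos])
      then show ?thesis using 1 *(3) fr g n_pos
        by (intro post) (auto simp: zeros_def)
    next
      case 2
      have sp: "[lo..<hi] = [lo..<j] @ j # [Suc j..<hi]"
        using 2(2,3) upt_add_eq_append[of lo j "hi - j"] upt_conv_Cons[of j hi] by simp
      have "map (A a) [lo..<hi] = replicate (j - lo) (n - 1) @ A a j # map (A a) [Suc j..<hi]"
        unfolding sp map_append rep[OF 2(5)] by simp
      moreover have "map (A' a) [lo..<hi] = replicate (j - lo) 0 @ Suc (A a j) # map (A a) [Suc j..<hi]"
        unfolding sp map_append 2(6) by (auto simp: zeros_def intro!: nth_equalityI)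
      ultimately have "val n (map (A' a) [lo..<hi]) = Suc (val n (map (A a) [lo..<hi]))"
        by (simp only: val_incr[OF n_pos])
      then show ?thesis using 2 *(3) fr g n_pos
        by (intro post) (auto simp: zeros_def)
    qed
  qed
  then show ?thesis using s M_large by (simp add: incr_prog_def wp_basic env_def)
qed

end

section \<open>The isomorphism test\<close>

text \<open>\<open>vQ\<close> runs through the odd powers \<open>2 ^ (2 * h - 1)\<close>, so the
  loop stops at the least \<open>h\<close> whose power reaches \<open>n\<close>. \<open>vOff\<close>
  becomes \<open>n * n + 1\<close>, the start of the second table.\<close>

definition init_prog :: com where
  "init_prog = Const vOne 1 ;; Input vN vZero ;; Const vH 1 ;; Const vQ 2 ;;
     WhileLess vQ vN (Plus vQ vQ vQ ;; Plus vQ vQ vQ ;; Plus vH vH vOne) ;;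
     Plus vM vH vH ;; Const vW 1 ;; Plus vU vN vZero ;; mul_prog ;; Plus vOff vW vZero ;; Const vF 1"

text \<open>The second half of \<open>aGB\<close> is overwritten in every round; only the first half
  is counted up. Tuples that do not generate H leave no mark, since a collision with one would only
  compare proper subgroups.\<close>

definition store_step :: com where
  "store_step = Plus vK vH vZero ;; Plus vHi vM vZero ;; complete_prog aGB ;; bfs_prog aGB ;;
     IfLess vLen vN (Const vU 0) (Write aDic vCode vOne) ;;
     Const vLo 0 ;; Plus vHi vH vZero ;; incr_prog aGB"

text \<open>\<open>aGA\<close> is still zero, so element 0 serves as the first, unrestricted entry
  of \<open>a\<close>, and the second half starts as the zero tuple.\<close>

definition prepare_prog :: com where
  "prepare_prog = Const vOff 1 ;; Const vK 1 ;; Plus vHi vH vZero ;; complete_prog aGA ;;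
     Plus vK vM vZero ;; Const vF 1"

definition lookup_step :: com where
  "lookup_step = bfs_prog aGA ;; Read vT aDic vCode ;;
     IfLess vZero vT (Const vRes 1) (Const vU 0) ;;
     Plus vLo vH vZero ;; Plus vHi vM vZero ;; incr_prog aGA"

definition iso_prog :: com where
  "iso_prog = init_prog ;; WhileLess vZero vF store_step ;; prepare_prog ;;
     WhileLess vZero vF lookup_step"

text \<open>\<open>h_min\<close> identifies \<open>h\<close> as the value found by
  \<open>init_prog\<close>, and it is the source of the bound on \<open>h\<close> by half the
  logarithm.\<close>

locale iso_algorithm = bounds x M n "2 * h" for x :: "nat list" and M n h :: nat +
  fixes G H :: "nat monoid"
  assumes G: "group G" "carrier G = {0..<n}" and H: "group H" "carrier H = {0..<n}"
    and h_pos: "0 < h" and n_le: "n \<le> 2 ^ (2 * h - 1)" and h_min: "h = 1 \<or> 2 ^ (2 * h - 3) < n"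
    and input_n: "input_at x 0 = n"
    and table_G: "table 1 (mult G)" and table_H: "table (n * n + 1) (mult H)"
begin

section \<open>Marking the codes of H\<close>

definition tuple :: "nat list \<Rightarrow> bool" where
  "tuple y \<longleftrightarrow> length y = h \<and> set y \<subseteq> {0..<n}"

text \<open>Every mark is witnessed by a generating tuple of H; this justifies positive
  answers.\<close>

definition sound :: "(nat \<Rightarrow> nat) \<Rightarrow> bool" where
  "sound D \<longleftrightarrow> (\<forall>c. D c \<noteq> 0 \<longrightarrow> (\<exists>b t. length b = 2 * h \<and> set b \<subseteq> {0..<n} \<and>
     stops (mult H) b t \<and> length (bfs (mult H) b t) = n \<and> c = code n (mult H) b t))"

text \<open>The counterpart of \<open>sound\<close>, for negative answers. The completion
  \<open>b\<close> is left existential, as any greedy one yields a collision.\<close>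

definition stored :: "(nat \<Rightarrow> nat) \<Rightarrow> nat list \<Rightarrow> bool" where
  "stored D y \<longleftrightarrow> (\<exists>b t. length b = 2 * h \<and> set b \<subseteq> {0..<n} \<and> take h b = y \<and> greedy H h b \<and>
     stops (mult H) b t \<and> (length (bfs (mult H) b t) = n \<longrightarrow> D (code n (mult H) b t) \<noteq> 0))"

definition base :: "nat \<Rightarrow> vars \<Rightarrow> bool" where
  "base l s \<longleftrightarrow> env s \<and> s vH = h \<and> s vM = 2 * h \<and> s vOff = l"

definition step_time :: nat where
  "step_time = 1 + (1 + (complete_time + (bfs_time + (2 + (1 + (1 + (7 * (2 * h) + 3)))))))"

text \<open>\<open>t\<close> counts the finished rounds and is the value of the next tuple, or
  \<open>n ^ h\<close> after overflow. The clause on \<open>aGA\<close> is kept for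
  \<open>prepare_prog\<close>.\<close>

definition store_inv :: "nat \<Rightarrow> vars \<Rightarrow> arrs \<Rightarrow> bool" where
  "store_inv t s A \<longleftrightarrow> base (n * n + 1) s \<and> s vRes = 0 \<and> A aGA = (\<lambda>_. 0) \<and> (\<forall>i<h. A aGB i < n) \<and>
     (s vF = 1 \<and> val n (map (A aGB) [0..<h]) = t \<or> s vF = 0 \<and> t = n ^ h) \<and>
     sound (A aDic) \<and> (\<forall>y. tuple y \<and> val n y < t \<longrightarrow> stored (A aDic) y)"

text \<open>Needed to read a failed test \<open>vLen < n\<close> as equality.\<close>

lemma length_bfs_le:
  assumes "group G'" "carrier G' = {0..<n}" "set g \<subseteq> {0..<n}" "g \<noteq> []" "stops (mult G') g t"
  shows "length (bfs (mult G') g t) \<le> n"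
proof -
  interpret group G' by fact
  have "set (bfs (mult G') g t) \<subseteq> {0..<n}"
    using assms m_closed by (intro bfs_subset) (auto simp: stops_def)
  then have "card (set (bfs (mult G') g t)) \<le> n" using card_mono[of "{0..<n}"] by auto
  then show ?thesis using distinct_card[OF distinct_bfs] by metis
qed

lemma stored_mono:
  assumes "stored D y" "\<And>c. D c \<noteq> 0 \<Longrightarrow> D' c \<noteq> 0"
  shows "stored D' y"
  using assms(1) unfolding stored_def by (elim exE) (use assms(2) in blast)

lemma wp_store_step:
  assumes inv: "store_inv t s A" and F: "s vZero < s vF"
  shows "t < n ^ h \<and> wp x M store_step (\<lambda>\<tau> s A. \<tau> \<le> step_time \<and> store_inv (Suc t) s A) s A"
proof -
  let ?y = "map (A aGB) [0..<h]"
  have s: "env s" "s vZero = 0" "s vOne = Suc 0" "s vN = n" "s vH = h" "s vM = 2 * h" "s vOff = n * n + 1"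
    "s vRes = 0" using inv by (auto simp: store_inv_def base_def env_def)
  have t: "val n ?y = t" using inv F s by (auto simp: store_inv_def)
  have y: "tuple ?y" using inv by (auto simp: store_inv_def tuple_def)
  then have tn: "t < n ^ h" using val_less[of ?y n] t by (auto simp: tuple_def)
  have last: "wp x M (IfLess vLen vN (Const vU 0) (Write aDic vCode vOne) ;; Const vLo 0 ;;
      Plus vHi vH vZero ;; incr_prog aGB)
    (\<lambda>\<tau> s A. \<tau> \<le> 2 + (1 + (1 + (7 * (2 * h) + 3))) \<and> store_inv (Suc t) s A) s2 A2"
    if s2: "base (n * n + 1) s2" "s2 vRes = 0" "A2 aGA = (\<lambda>_. 0)" "A2 aDic = A aDic"
      and b: "b = map (A2 aGB) [0..<2 * h]" "set b \<subseteq> {0..<n}" "take h b = ?y" "greedy H h b"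
        "stops (mult H) b t'" "s2 vLen = length (bfs (mult H) b t')" "s2 vCode = code n (mult H) b t'"
    for s2 A2 b t'
  proof -
    define A3 where "A3 = (if s2 vLen < n then A2 else A2(aDic := (A2 aDic)(s2 vCode := 1)))"
    have e: "s2 vZero = 0" "s2 vOne = Suc 0" "s2 vN = n" "s2 vH = h"
      using s2(1) by (auto simp: base_def env_def)
    have lenb: "length b = 2 * h" using b(1) by simp
    have A3G: "A3 aGB = A2 aGB" "A3 aGA = (\<lambda>_. 0)" using s2 by (auto simp: A3_def)
    have A3D: "A3 aDic = (if s2 vLen < n then A aDic else (A aDic)(code n (mult H) b t' := 1))"
      using s2 b by (simp add: A3_def)
    have "b \<noteq> []" using lenb h_pos by auto
    have len: "length (bfs (mult H) b t') \<le> n" by (rule length_bfs_le[OF H b(2) \<open>b \<noteq> []\<close> b(5)])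
    have ty: "map (A2 aGB) [0..<h] = ?y"
    proof -
      have "take h [0..<2 * h] = [0..<h]" by simp
      then show ?thesis using b(1,3) by (simp add: take_map)
    qed
    have lt: "A2 aGB i < n" if "i < h" for i
      using b(1,2) that by (auto simp: subset_iff)
    have mono: "A aDic c \<noteq> 0 \<Longrightarrow> A3 aDic c \<noteq> 0" for c by (simp add: A3D)
    have sd: "sound (A3 aDic)"
    proof -
      have *: "sound (A aDic)" using inv by (simp add: store_inv_def)
      show ?thesis
      proof (cases "s2 vLen < n")
        case True
        with * show ?thesis by (simp add: A3D)
      next
        case False
        then have "length (bfs (mult H) b t') = n" using b(6) len by simp
        with * b(2,5) lenb show ?thesis unfolding A3D sound_def by auto
      qed
    qed
    have st: "stored (A3 aDic) y" if "tuple y" "val n y < Suc t" for y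
    proof (cases "val n y < t")
      case True
      then have "stored (A aDic) y" using inv that by (simp add: store_inv_def)
      then show ?thesis using mono by (rule stored_mono)
    next
      case False
      \<comment> \<open>The only tuple not covered by the invariant is the current one, as
        \<open>val\<close> is injective.\<close>
      then have "val n y = val n ?y" using that t by simp
      then have "y = ?y" using that(1) y by (intro val_inj[of y ?y n]) (auto simp: tuple_def)
      moreover have "length (bfs (mult H) b t') = n \<longrightarrow> A3 aDic (code n (mult H) b t') \<noteq> 0"
        using b(6) by (simp add: A3D)
      ultimately show ?thesis using b lenb unfolding stored_def by metis
    qed
    show ?thesis
    proof (rule wp_seq)
      have rest: "wp x M (Const vLo 0 ;; Plus vHi vH vZero ;; incr_prog aGB)
        (\<lambda>\<tau> s A. \<tau> \<le> 1 + (1 + (7 * (2 * h) + 3)) \<and> store_inv (Suc t) s A) s3 A3"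
        if "s3 = s2 \<or> s3 = s2(vU := 0)" for s3
      proof (rule wp_seq_Const)
        show "0 < M" using M_large by simp
        show "wp x M (Plus vHi vH vZero ;; incr_prog aGB)
          (\<lambda>\<tau> s A. \<tau> \<le> 1 + (7 * (2 * h) + 3) \<and> store_inv (Suc t) s A) (s3(vLo := 0)) A3"
        proof (rule wp_seq_Plus)
          show "(s3(vLo := 0)) vH + (s3(vLo := 0)) vZero < M" using M_large e that by auto
          let ?s = "s3(vLo := 0, vHi := (s3(vLo := 0)) vH + (s3(vLo := 0)) vZero)"
          have bs: "base (n * n + 1) ?s" "?s vRes = 0" using s2 that by (auto simp: base_def env_def)
          show "wp x M (incr_prog aGB) (\<lambda>\<tau> s A. \<tau> \<le> 7 * (2 * h) + 3 \<and> store_inv (Suc t) s A) ?s A3"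
          proof (rule wp_incr[where lo = 0 and hi = h])
            show "env ?s" using bs unfolding base_def by blast
            show "?s vLo = 0" "?s vHi = h" using e that by auto
            show "A3 aGB i < n" if "i < h" for i using lt[OF that] A3G by simp
          next
            fix \<tau> s' A'
            assume *: "\<tau> \<le> 7 * (2 * h) + 3" "s' vF = 1 \<and> val n (map (A' aGB) [0..<h]) = Suc (val n (map (A3 aGB) [0..<h])) \<or>
              s' vF = 0 \<and> Suc (val n (map (A3 aGB) [0..<h])) = n ^ (h - 0)"
              "\<forall>i. 0 \<le> i \<and> i < h \<longrightarrow> A' aGB i < n" "\<forall>v. v \<notin> {vI, vF, vT} \<longrightarrow> s' v = ?s v"
              "\<forall>b. b \<noteq> aGB \<longrightarrow> A' b = A3 b"
            have "base (n * n + 1) s'" "s' vRes = 0" using bs *(4) by (auto simp: base_def env_def)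
            then show "\<tau> \<le> 7 * (2 * h) + 3 \<and> store_inv (Suc t) s' A'"
              using * sd st ty t A3G by (auto simp: store_inv_def)
          qed (use h_pos in auto)
        qed
      qed
      show "wp x M (IfLess vLen vN (Const vU 0) (Write aDic vCode vOne)) (\<lambda>\<tau> s A. \<tau> \<le> 2 \<and>
         wp x M (Const vLo 0 ;; Plus vHi vH vZero ;; incr_prog aGB)
           (\<lambda>\<tau> s A. \<tau> \<le> 1 + (1 + (7 * (2 * h) + 3)) \<and> store_inv (Suc t) s A) s A) s2 A2"
      proof (cases "s2 vLen < n")
        case True
        then have "A3 = A2" by (simp add: A3_def)
        with True rest[of "s2(vU := 0)"] M_large show ?thesis by (simp add: wp_basic(1) wp_if e)
      next
        case False
        then have "A3 = A2(aDic := (A2 aDic)(s2 vCode := Suc 0))" by (simp add: A3_def)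
        with False rest[of s2] show ?thesis by (simp add: wp_basic(5) wp_if e)
      qed
    qed
  qed
  have "wp x M store_step (\<lambda>\<tau> s A. \<tau> \<le> step_time \<and> store_inv (Suc t) s A) s A"
    unfolding store_step_def step_time_def
  proof (rule wp_seq_Plus, goal_cases)
    case 1
    show ?case using s M_large by simp
  next
    case 2
    show ?case
    proof (rule wp_seq_Plus, goal_cases)
      case 1
      show ?case using s M_large by simp
    next
      case 2
      let ?s = "s(vK := s vH + s vZero, vHi := (s(vK := s vH + s vZero)) vM + (s(vK := s vH + s vZero)) vZero)"
      show ?case
      proof (rule wp_seq, rule wp_complete[where l = "n * n + 1" and k = h and hi = "2 * h", OF _ _ table_H _ _ H])
        show "env ?s" "?s vOff = n * n + 1" "?s vK = h" "?s vHi = 2 * h" using s by (auto simp: env_def)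
        show "0 < h" "h \<le> 2 * h" "2 * h \<le> 2 * h" "aGB = aGA \<or> aGB = aGB" using h_pos by auto
        show "A aGB i < n" if "i < h" for i using inv that by (simp add: store_inv_def)
        fix \<tau> s1 A1
        assume 1: "\<tau> \<le> complete_time" "s1 vK = 2 * h" "\<forall>i. i < h \<or> 2 * h \<le> i \<longrightarrow> A1 aGB i = A aGB i"
          "\<forall>i<2 * h. A1 aGB i < n" "greedy H h (map (A1 aGB) [0..<2 * h])" "complete_frame aGB ?s A s1 A1"
        have s1: "base (n * n + 1) s1" "s1 vRes = 0" using 1(6) s by (auto simp: complete_frame_def base_def env_def)
        have A1: "A1 aGA = (\<lambda>_. 0)" "A1 aDic = A aDic"
          using 1(6) inv by (auto simp: complete_frame_def store_inv_def)
        have "wp x M (bfs_prog aGB ;; IfLess vLen vN (Const vU 0) (Write aDic vCode vOne) ;; Const vLo 0 ;;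
          Plus vHi vH vZero ;; incr_prog aGB)
          (\<lambda>\<tau> s A. \<tau> \<le> bfs_time + (2 + (1 + (1 + (7 * (2 * h) + 3)))) \<and> store_inv (Suc t) s A) s1 A1"
        proof (rule wp_seq, rule wp_bfs[where l = "n * n + 1" and k = "2 * h" and A = A1 and a = aGB, OF _ _ table_H])
          show "env s1" "s1 vOff = n * n + 1" using s1 by (auto simp: base_def)
          show "s1 vK = 2 * h" by fact
          show "A1 aGB i < n" if "i < 2 * h" for i using 1(4) that by simp
          show "0 < 2 * h" "2 * h \<le> 2 * h" "aGB = aGA \<or> aGB = aGB" using h_pos by auto
          fix \<tau> s2 A2 t'
          assume 2: "\<tau> \<le> bfs_time" "stops (mult H) (map (A1 aGB) [0..<2 * h]) t'"
            "s2 vLen = length (bfs (mult H) (map (A1 aGB) [0..<2 * h]) t')"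
            "s2 vCode = code n (mult H) (map (A1 aGB) [0..<2 * h]) t'" "bfs_frame s1 A1 s2 A2"
          have A2: "A2 aGB = A1 aGB" "A2 aGA = (\<lambda>_. 0)" "A2 aDic = A aDic"
            using 2(5) A1 by (auto simp: bfs_frame_def)
          have s2: "base (n * n + 1) s2" "s2 vRes = 0" using 2(5) s1 by (auto simp: bfs_frame_def base_def env_def)
          have tk: "take h (map (A1 aGB) [0..<2 * h]) = ?y"
          proof -
            have "take h [0..<2 * h] = [0..<h]" by simp
            then show ?thesis using 1(3) by (simp add: take_map)
          qed
          show "\<tau> \<le> bfs_time \<and> wp x M (IfLess vLen vN (Const vU 0) (Write aDic vCode vOne) ;; Const vLo 0 ;;
              Plus vHi vH vZero ;; incr_prog aGB)
            (\<lambda>\<tau> s A. \<tau> \<le> 2 + (1 + (1 + (7 * (2 * h) + 3))) \<and> store_inv (Suc t) s A) s2 A2"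
          proof (intro conjI)
            show "\<tau> \<le> bfs_time" by fact
            show "wp x M (IfLess vLen vN (Const vU 0) (Write aDic vCode vOne) ;; Const vLo 0 ;;
              Plus vHi vH vZero ;; incr_prog aGB)
            (\<lambda>\<tau> s A. \<tau> \<le> 2 + (1 + (1 + (7 * (2 * h) + 3))) \<and> store_inv (Suc t) s A) s2 A2"
              by (rule last[OF s2 A2(2,3) _ _ tk 1(5) 2(2-4)]) (use A2 1(4) in auto)
          qed
        qed
        with 1(1) show "\<tau> \<le> complete_time \<and> wp x M (bfs_prog aGB ;; IfLess vLen vN (Const vU 0) (Write aDic vCode vOne) ;;
          Const vLo 0 ;; Plus vHi vH vZero ;; incr_prog aGB)
          (\<lambda>\<tau> s A. \<tau> \<le> bfs_time + (2 + (1 + (1 + (7 * (2 * h) + 3)))) \<and> store_inv (Suc t) s A) s1 A1" by simp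
      qed
    qed
  qed
  with tn show ?thesis by simp
qed

text \<open>The last two clauses say that \<open>vRes = 1\<close> is always justified and that no
  hit among the first \<open>t\<close> tuples was missed. \<open>D\<close> and \<open>a\<close> are
  parameters because lookups change neither the marks nor the first half of the tuple.\<close>

definition lookup_inv :: "(nat \<Rightarrow> nat) \<Rightarrow> nat list \<Rightarrow> nat \<Rightarrow> vars \<Rightarrow> arrs \<Rightarrow> bool" where
  "lookup_inv D a t s A \<longleftrightarrow> base 1 s \<and> s vK = 2 * h \<and> A aDic = D \<and> (\<forall>i<2 * h. A aGA i < n) \<and>
     map (A aGA) [0..<h] = a \<and>
     (s vF = 1 \<and> val n (map (A aGA) [h..<2 * h]) = t \<or> s vF = 0 \<and> t = n ^ h) \<and> s vRes \<le> 1 \<and>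
     (s vRes = 1 \<longrightarrow> (\<exists>b t. length b = 2 * h \<and> set b \<subseteq> {0..<n} \<and> stops (mult G) b t \<and>
        D (code n (mult G) b t) \<noteq> 0)) \<and>
     (\<forall>y t'. tuple y \<and> val n y < t \<and> stops (mult G) (a @ y) t' \<and>
        D (code n (mult G) (a @ y) t') \<noteq> 0 \<longrightarrow> s vRes = 1)"

definition lookup_time :: nat where
  "lookup_time = bfs_time + (1 + (2 + (1 + (1 + (7 * (2 * h) + 3)))))"

lemma wp_lookup_step:
  assumes inv: "lookup_inv D a t s A" and F: "s vZero < s vF"
  shows "t < n ^ h \<and> wp x M lookup_step (\<lambda>\<tau> s A. \<tau> \<le> lookup_time \<and> lookup_inv D a (Suc t) s A) s A"
proof -
  let ?y = "map (A aGA) [h..<2 * h]" and ?b = "map (A aGA) [0..<2 * h]"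
  have s: "env s" "s vOff = 1" "s vZero = 0" "s vOne = Suc 0" "s vN = n" "s vH = h" "s vM = 2 * h" "s vK = 2 * h"
    using inv by (auto simp: lookup_inv_def base_def env_def)
  have ab: "?b = a @ ?y"
    using inv upt_add_eq_append[of 0 h h] by (auto simp: lookup_inv_def mult_2)
  have t: "val n ?y = t" using inv F s by (auto simp: lookup_inv_def)
  have y: "tuple ?y" using inv by (auto simp: lookup_inv_def tuple_def)
  then have tn: "t < n ^ h" using val_less[of ?y n] t by (auto simp: tuple_def)
  have rest: "wp x M (Plus vLo vH vZero ;; Plus vHi vM vZero ;; incr_prog aGA)
    (\<lambda>\<tau> s A. \<tau> \<le> 1 + (1 + (7 * (2 * h) + 3)) \<and> lookup_inv D a (Suc t) s A) s2 A2"
    if s2: "base 1 s2" "s2 vK = 2 * h" "A2 aDic = D" "A2 aGA = A aGA" "s2 vRes = (if D c = 0 then s vRes else 1)"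
      and st: "stops (mult G) ?b t'" "c = code n (mult G) ?b t'" for s2 A2 c t'
  proof -
    have e: "s2 vZero = 0" "s2 vH = h" "s2 vM = 2 * h" using s2(1) by (auto simp: base_def env_def)
    have res: "s2 vRes \<le> 1" "s2 vRes = 1 \<longrightarrow> (\<exists>b t. length b = 2 * h \<and> set b \<subseteq> {0..<n} \<and>
        stops (mult G) b t \<and> D (code n (mult G) b t) \<noteq> 0)"
    proof -
      show "s2 vRes \<le> 1" using inv s2(5) by (auto simp: lookup_inv_def)
      have "set ?b \<subseteq> {0..<n}" using inv by (auto simp: lookup_inv_def)
      then have "D c \<noteq> 0 \<longrightarrow> (\<exists>b t. length b = 2 * h \<and> set b \<subseteq> {0..<n} \<and>
        stops (mult G) b t \<and> D (code n (mult G) b t) \<noteq> 0)" using st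
        by (intro impI exI[of _ ?b] exI[of _ t']) auto
      then show "s2 vRes = 1 \<longrightarrow> (\<exists>b t. length b = 2 * h \<and> set b \<subseteq> {0..<n} \<and>
        stops (mult G) b t \<and> D (code n (mult G) b t) \<noteq> 0)"
        using inv s2(5) by (cases "D c = 0") (simp_all add: lookup_inv_def)
    qed
    have fnd: "s2 vRes = 1" if "tuple z" "val n z < Suc t" "stops (mult G) (a @ z) t''"
      "D (code n (mult G) (a @ z) t'') \<noteq> 0" for z t''
    proof (cases "val n z < t")
      case True
      then have "s vRes = 1" using that inv unfolding lookup_inv_def by blast
      then show ?thesis using s2(5) by simp
    next
      case False
      then have "z = ?y" using that(1,2) y t by (intro val_inj[of z ?y n]) (auto simp: tuple_def)
      then have "a @ z = ?b" using ab by simp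
      \<comment> \<open>The stopping time is unique, so a tuple has only one code.\<close>
      moreover from this have "t'' = t'" using st(1) that(3) stops_unique by metis
      ultimately have "D c \<noteq> 0" using that(4) st(2) by simp
      then show ?thesis using s2(5) by simp
    qed
    show ?thesis
    proof (rule wp_seq_Plus, goal_cases)
      case 1
      show ?case using e M_large by simp
    next
      case 2
      show ?case
      proof (rule wp_seq_Plus, goal_cases)
        case 1
        show ?case using e M_large by simp
      next
        case 2
        let ?s = "s2(vLo := s2 vH + s2 vZero, vHi := (s2(vLo := s2 vH + s2 vZero)) vM + (s2(vLo := s2 vH + s2 vZero)) vZero)"
        show ?case
        proof (rule wp_incr[where lo = h and hi = "2 * h"])
          show "env ?s" using s2(1) by (simp add: base_def env_def)
          show "?s vLo = h" "?s vHi = 2 * h" using e by auto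
          show "A2 aGA i < n" if "i < 2 * h" for i using inv that s2(4) by (simp add: lookup_inv_def)
        next
          fix \<tau> s' A'
          assume *: "\<tau> \<le> 7 * (2 * h) + 3"
            "s' vF = 1 \<and> val n (map (A' aGA) [h..<2 * h]) = Suc (val n (map (A2 aGA) [h..<2 * h])) \<or>
              s' vF = 0 \<and> Suc (val n (map (A2 aGA) [h..<2 * h])) = n ^ (2 * h - h)"
            "\<forall>i. h \<le> i \<and> i < 2 * h \<longrightarrow> A' aGA i < n" "\<forall>i. i < h \<or> 2 * h \<le> i \<longrightarrow> A' aGA i = A2 aGA i"
            "\<forall>v. v \<notin> {vI, vF, vT} \<longrightarrow> s' v = ?s v" "\<forall>b. b \<noteq> aGA \<longrightarrow> A' b = A2 b"
          have "base 1 s'" "s' vK = 2 * h" "s' vRes = s2 vRes" using s2 *(5) by (auto simp: base_def env_def)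
          moreover have "A' aDic = D" using *(6) s2 by auto
          moreover have "\<forall>i<2 * h. A' aGA i < n"
          proof (intro allI impI)
            fix i assume "i < 2 * h"
            then show "A' aGA i < n" using *(3,4) inv s2(4) by (cases "i < h") (auto simp: lookup_inv_def)
          qed
          moreover have "map (A' aGA) [0..<h] = a" using *(4) inv s2(4) by (auto simp: lookup_inv_def)
          moreover have "s' vF = 1 \<and> val n (map (A' aGA) [h..<2 * h]) = Suc t \<or> s' vF = 0 \<and> Suc t = n ^ h"
            using *(2) t s2(4) by simp
          ultimately show "\<tau> \<le> 7 * (2 * h) + 3 \<and> lookup_inv D a (Suc t) s' A'"
            using *(1) res fnd unfolding lookup_inv_def by simp blast
        qed (use h_pos in auto)
      qed
    qed
  qed
  have "wp x M lookup_step (\<lambda>\<tau> s A. \<tau> \<le> lookup_time \<and> lookup_inv D a (Suc t) s A) s A"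
    unfolding lookup_step_def lookup_time_def
  proof (rule wp_seq, rule wp_bfs[where l = 1 and k = "2 * h" and A = A and a = aGA, OF s(1,2) table_G s(8)])
    show "A aGA i < n" if "i < 2 * h" for i using inv that by (simp add: lookup_inv_def)
    show "0 < 2 * h" "2 * h \<le> 2 * h" "aGA = aGA \<or> aGA = aGB" using h_pos by auto
    fix \<tau> s1 A1 t'
    assume 1: "\<tau> \<le> bfs_time" "stops (mult G) ?b t'" "s1 vCode = code n (mult G) ?b t'" "bfs_frame s A s1 A1"
    have s1: "base 1 s1" "s1 vK = 2 * h" "s1 vRes = s vRes" "s1 vZero = 0"
      using 1(4) s by (auto simp: bfs_frame_def base_def env_def)
    have A1: "A1 aGA = A aGA" "A1 aDic = D" using 1(4) inv by (auto simp: bfs_frame_def lookup_inv_def)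
    have "wp x M (Read vT aDic vCode ;; IfLess vZero vT (Const vRes 1) (Const vU 0) ;;
      Plus vLo vH vZero ;; Plus vHi vM vZero ;; incr_prog aGA)
      (\<lambda>\<tau> s A. \<tau> \<le> 1 + (2 + (1 + (1 + (7 * (2 * h) + 3)))) \<and> lookup_inv D a (Suc t) s A) s1 A1"
    proof (rule wp_seq_Read, rule wp_seq)
      let ?c = "code n (mult G) ?b t'"
      let ?s2 = "if D ?c = 0 then s1(vT := 0, vU := 0) else s1(vT := D ?c, vRes := 1)"
      have "wp x M (Plus vLo vH vZero ;; Plus vHi vM vZero ;; incr_prog aGA)
        (\<lambda>\<tau> s A. \<tau> \<le> 1 + (1 + (7 * (2 * h) + 3)) \<and> lookup_inv D a (Suc t) s A) ?s2 A1"
        by (rule rest[where c = ?c, OF _ _ A1(2,1) _ 1(2)]) (use s1 in \<open>auto simp: base_def env_def\<close>)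
      then show "wp x M (IfLess vZero vT (Const vRes 1) (Const vU 0)) (\<lambda>\<tau> s A. \<tau> \<le> 2 \<and>
        wp x M (Plus vLo vH vZero ;; Plus vHi vM vZero ;; incr_prog aGA)
        (\<lambda>\<tau> s A. \<tau> \<le> 1 + (1 + (7 * (2 * h) + 3)) \<and> lookup_inv D a (Suc t) s A) s A)
        (s1(vT := A1 aDic (s1 vCode))) A1"
        using s1 1(3) M_large by (cases "D ?c = 0") (simp_all add: wp_if wp_basic(1) A1)
    qed
    with 1(1) show "\<tau> \<le> bfs_time \<and> wp x M (Read vT aDic vCode ;; IfLess vZero vT (Const vRes 1) (Const vU 0) ;;
      Plus vLo vH vZero ;; Plus vHi vM vZero ;; incr_prog aGA)
      (\<lambda>\<tau> s A. \<tau> \<le> 1 + (2 + (1 + (1 + (7 * (2 * h) + 3)))) \<and> lookup_inv D a (Suc t) s A) s1 A1" by simp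
  qed
  with tn show ?thesis by simp
qed

lemma wp_prepare:
  assumes "base l s" "s vRes = 0" "A aGA = (\<lambda>_. 0)"
  shows "wp x M prepare_prog (\<lambda>\<tau> s' A'. \<tau> \<le> 1 + (1 + (1 + (complete_time + 2))) \<and>
    (\<exists>a. tuple a \<and> greedy G 1 a \<and> lookup_inv (A aDic) a 0 s' A')) s A"
  unfolding prepare_prog_def
proof (rule wp_seq_Const, goal_cases)
  case 1
  show ?case using M_large by simp
next
  case 2
  show ?case
  proof (rule wp_seq_Const, goal_cases)
    case 1
    show ?case using M_large by simp
  next
    case 2
    let ?s' = "s(vOff := 1, vK := 1)"
    show ?case
    proof (rule wp_seq_Plus, goal_cases)
      case 1
      show ?case using M_large assms(1) by (simp add: base_def env_def)
    next
      case 2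
      let ?s = "?s'(vHi := ?s' vH + ?s' vZero)"
      show ?case
      proof (rule wp_seq, rule wp_complete[where l = 1 and k = 1 and hi = h, OF _ _ table_G _ _ G])
        show "env ?s" "?s vOff = 1" "?s vK = 1" "?s vHi = h" using assms(1) by (auto simp: base_def env_def)
        show "A aGA i < n" for i using assms(3) n_pos by simp
        show "(0::nat) < 1" "1 \<le> h" "h \<le> 2 * h" "aGA = aGA \<or> aGA = aGB" using h_pos by auto
        fix \<tau> s1 A1
        assume 1: "\<tau> \<le> complete_time" "\<forall>i. i < 1 \<or> h \<le> i \<longrightarrow> A1 aGA i = A aGA i" "\<forall>i<h. A1 aGA i < n"
          "greedy G 1 (map (A1 aGA) [0..<h])" "complete_frame aGA ?s A s1 A1"
        let ?a = "map (A1 aGA) [0..<h]" and ?s2 = "s1(vK := 2 * h, vF := 1)"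
        have s1: "base 1 ?s2" "s1 vM = 2 * h" "s1 vZero = 0" "s1 vRes = 0"
          using 1(5) assms(1,2) by (auto simp: complete_frame_def base_def env_def)
        \<comment> \<open>Completion stops at \<open>h\<close>; the entries behind it are still 0,
          so counting starts at value 0.\<close>
        have "map (A1 aGA) [h..<2 * h] = replicate h 0"
          using 1(2) assms(3) by (intro nth_equalityI) auto
        then have "val n (map (A1 aGA) [h..<2 * h]) = 0" by (simp add: val_replicate_0)
        moreover have "A1 aGA i < n" for i using 1(2,3) assms(3) n_pos by (cases "i < h") auto
        moreover have "A1 aDic = A aDic" using 1(5) by (auto simp: complete_frame_def)
        ultimately have "lookup_inv (A aDic) ?a 0 ?s2 A1"
          using s1 by (simp add: lookup_inv_def)
        moreover have "tuple ?a" using 1(3) by (auto simp: tuple_def)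
        ultimately show "\<tau> \<le> complete_time \<and> wp x M (Plus vK vM vZero ;; Const vF 1) (\<lambda>\<tau> s' A'. \<tau> \<le> 2 \<and>
            (\<exists>a. tuple a \<and> greedy G 1 a \<and> lookup_inv (A aDic) a 0 s' A')) s1 A1"
          using 1(1,4) s1 M_large by (auto simp: wp_basic)
      qed
    qed
  qed
qed

lemma wp_init:
  "wp x M init_prog (\<lambda>\<tau> s A. \<tau> \<le> 4 * h + 3 * n + 12 \<and> store_inv 0 s A) (\<lambda>_. 0) (\<lambda>_ _. 0)"
proof -
  let ?s = "(\<lambda>_. 0)(vOne := 1, vN := n)"
  have h4: "2 * h + 10 < M" "n * n + n + 10 < M" "1 < M" "2 < M" using M_large by auto
  have loop: "wp x M (WhileLess vQ vN (Plus vQ vQ vQ ;; Plus vQ vQ vQ ;; Plus vH vH vOne))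
    (\<lambda>\<tau> s A. \<tau> \<le> 4 * h + 1 \<and> (\<exists>q. s = ?s(vQ := q, vH := h)) \<and> A = (\<lambda>_ _. 0)) (?s(vH := 1, vQ := 2)) (\<lambda>_ _. 0)"
  proof (rule wp_while[where m = h and b = 3 and
      Inv = "\<lambda>t s A. Suc t \<le> h \<and> s = ?s(vQ := 2 ^ (2 * t + 1), vH := Suc t) \<and> A = (\<lambda>_ _. 0)"])
    show "Suc 0 \<le> h \<and> ?s(vH := 1, vQ := 2) = ?s(vQ := 2 ^ (2 * 0 + 1), vH := Suc 0) \<and> (\<lambda>_ _. 0) = (\<lambda>_ _. 0::nat)"
      using h_pos by (auto simp: fun_eq_iff)
  next
    fix t and s :: vars and A :: arrs
    assume *: "Suc t \<le> h \<and> s = ?s(vQ := 2 ^ (2 * t + 1), vH := Suc t) \<and> A = (\<lambda>_ _. 0)" "s vQ < s vN"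
    then have lt: "2 ^ (2 * t + 1) < n" by simp
    then have "(2::nat) ^ (2 * t + 1) < 2 ^ (2 * h - 1)" using n_le by simp
    then have "2 * t + 1 < 2 * h - 1" by (rule power_less_imp_less_exp[rotated]) simp
    then have "Suc (Suc t) \<le> h" by simp
    moreover have "4 * 2 ^ (2 * t + 1) < M" using lt M_large by linarith
    ultimately show "t < h \<and> wp x M (Plus vQ vQ vQ ;; Plus vQ vQ vQ ;; Plus vH vH vOne) (\<lambda>\<tau> s A. \<tau> \<le> 3 \<and>
      Suc (Suc t) \<le> h \<and> s = ?s(vQ := 2 ^ (2 * Suc t + 1), vH := Suc (Suc t)) \<and> A = (\<lambda>_ _. 0)) s A"
      using * h4 by (auto simp: wp_basic fun_eq_iff)
  next
    fix t \<tau> and s :: vars and A :: arrs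
    assume *: "Suc t \<le> h \<and> s = ?s(vQ := 2 ^ (2 * t + 1), vH := Suc t) \<and> A = (\<lambda>_ _. 0)" "\<not> s vQ < s vN"
      "\<tau> \<le> h * (3 + 1) + 1"
    then have ge: "n \<le> 2 ^ (2 * t + 1)" by simp
    \<comment> \<open>Stopping before \<open>h\<close> would contradict \<open>h_min\<close>, by
      which even the power with exponent \<open>2 * h - 3\<close>, that of the preceding round, is
      below \<open>n\<close>.\<close>
    have "h = Suc t"
    proof (rule ccontr)
      assume "h \<noteq> Suc t"
      then have "2 * t + 1 \<le> 2 * h - 3" "h \<noteq> 1" using * by auto
      then have "(2::nat) ^ (2 * t + 1) \<le> 2 ^ (2 * h - 3)" by (intro power_increasing) auto
      with ge h_min \<open>h \<noteq> 1\<close> show False by simp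
    qed
    then show "\<tau> \<le> 4 * h + 1 \<and> (\<exists>q. s = ?s(vQ := q, vH := h)) \<and> A = (\<lambda>_ _. 0)" using * by auto
  qed
  have h5: "h + h < M" "n < M" "Suc 0 < M" using h4 by auto
  have rest: "wp x M (Plus vM vH vH ;; Const vW 1 ;; Plus vU vN vZero ;; mul_prog ;; Plus vOff vW vZero ;; Const vF 1)
    (\<lambda>\<tau> s A. \<tau> \<le> 3 * n + 6 \<and> store_inv 0 s A) (?s(vQ := q, vH := h)) (\<lambda>_ _. 0)" for q
    apply (simp add: wp_basic h5)
    apply (rule wp_mul)
    subgoal by (simp add: env_def)
    subgoal using h4 by simp
    subgoal using h4 n_pos
      by (auto simp: wp_basic store_inv_def base_def env_def sound_def val_replicate_0 map_replicate_const)
    done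
  have "wp x M init_prog (\<lambda>\<tau> s A. \<tau> \<le> 1 + (1 + (1 + (1 + ((4 * h + 1) + (3 * n + 6))))) \<and> store_inv 0 s A) (\<lambda>_. 0) (\<lambda>_ _. 0)"
    unfolding init_prog_def
    apply (rule wp_seq_Const)
    subgoal using h4 by simp
    apply (rule wp_seq)
    apply (simp only: wp_basic(6) fun_upd_apply var.distinct simp_thms if_False input_n)
    apply (rule conjI, simp)
    apply (rule wp_seq_Const)
    subgoal using h4 by simp
    apply (rule wp_seq_Const)
    subgoal using h4 by simp
    apply (rule wp_seq)
    apply (rule wp_mono)
     apply (rule loop)
    apply (use rest in auto)
    done
  then show ?thesis by (rule wp_mono) auto
qed

text \<open>A hit and \<open>sound\<close> give generating tuples with equal codes. Conversely,
  \<open>stored\<close> is applied to the image of \<open>a\<close> under an isomorphism, and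
  \<open>collision\<close> supplies the matching \<open>y\<close>.\<close>

lemma iso_iff_collision:
  assumes "sound D" "\<And>y. tuple y \<Longrightarrow> stored D y" "tuple a" "greedy G 1 a"
  shows "(\<exists>b t. length b = 2 * h \<and> set b \<subseteq> {0..<n} \<and> stops (mult G) b t \<and> D (code n (mult G) b t) \<noteq> 0)
      \<Longrightarrow> G \<cong> H"
    and "G \<cong> H \<Longrightarrow> \<exists>y t. tuple y \<and> stops (mult G) (a @ y) t \<and> D (code n (mult G) (a @ y) t) \<noteq> 0"
proof -
  have card: "finite (carrier G)" "card (carrier G) = n" "finite (carrier H)" "card (carrier H) = n"
    using G H by auto
  assume "\<exists>b t. length b = 2 * h \<and> set b \<subseteq> {0..<n} \<and> stops (mult G) b t \<and> D (code n (mult G) b t) \<noteq> 0"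
  then obtain b t where b: "length b = 2 * h" "set b \<subseteq> {0..<n}" "stops (mult G) b t"
    "D (code n (mult G) b t) \<noteq> 0" by blast
  with assms(1) obtain b' t' where b': "length b' = 2 * h" "set b' \<subseteq> {0..<n}" "stops (mult H) b' t'"
    "length (bfs (mult H) b' t') = n" "code n (mult G) b t = code n (mult H) b' t'"
    unfolding sound_def by blast
  have "b \<noteq> []" using b(1) h_pos by auto
  then show "G \<cong> H"
    using b b' G H by (intro iso_if_same_code[OF G(1) H(1) card _ _ _ _ b(3) b'(3,5,4)]) auto
next
  have card: "finite (carrier G)" "card (carrier G) = n" "finite (carrier H)" "card (carrier H) = n"
    using G H by auto
  assume "G \<cong> H"
  then obtain \<phi> where \<phi>: "\<phi> \<in> iso G H" by (auto simp: is_iso_def)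
  have a: "length a = h" "set a \<subseteq> carrier G" using assms(3) G by (auto simp: tuple_def)
  have "\<phi> ` carrier G = carrier H" using \<phi> by (simp add: iso_def bij_betw_def)
  then have "tuple (map \<phi> a)" using a H(2) by (auto simp: tuple_def)
  from assms(2)[OF this] obtain b t where b: "length b = 2 * h" "set b \<subseteq> carrier H" "greedy H h b"
    "take h b = map \<phi> a" and st: "stops (mult H) b t"
      "length (bfs (mult H) b t) = n \<longrightarrow> D (code n (mult H) b t) \<noteq> 0"
    unfolding stored_def H(2) by blast
  from collision[OF G(1) H(1) card n_le h_pos \<phi> a assms(4) b st(1)] st(2) G(2)
  show "\<exists>y t. tuple y \<and> stops (mult G) (a @ y) t \<and> D (code n (mult G) (a @ y) t) \<noteq> 0"
    unfolding tuple_def by metis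
qed

definition total_time :: nat where
  "total_time = (4 * h + 3 * n + 12) + ((n ^ h * (step_time + 1) + 1) +
     ((1 + (1 + (1 + (complete_time + 2)))) + (n ^ h * (lookup_time + 1) + 1)))"

text \<open>Each loop ends with \<open>t = n ^ h\<close>, and every tuple has a value below that, so
  at the exit the invariants speak of all tuples.\<close>

theorem wp_iso_prog:
  "wp x M iso_prog (\<lambda>\<tau> s A. \<tau> \<le> total_time \<and> s vRes = (if G \<cong> H then 1 else 0)) (\<lambda>_. 0) (\<lambda>_ _. 0)"
  unfolding iso_prog_def total_time_def
proof (rule wp_seq, rule wp_mono[OF wp_init], elim conjE, rule conjI, assumption, rule wp_seq)
  fix s A assume "store_inv 0 s A"
  then show "wp x M (WhileLess vZero vF store_step) (\<lambda>\<tau> s A. \<tau> \<le> n ^ h * (step_time + 1) + 1 \<and>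
    wp x M (prepare_prog ;; WhileLess vZero vF lookup_step) (\<lambda>\<tau> s A.
      \<tau> \<le> (1 + (1 + (1 + (complete_time + 2)))) + (n ^ h * (lookup_time + 1) + 1) \<and>
      s vRes = (if G \<cong> H then 1 else 0)) s A) s A"
  proof (rule wp_while[where Inv = store_inv])
    show "t < n ^ h \<and> wp x M store_step (\<lambda>\<tau> s A. \<tau> \<le> step_time \<and> store_inv (Suc t) s A) s A"
      if "store_inv t s A" "s vZero < s vF" for t s A by (rule wp_store_step[OF that])
    fix t s A \<tau>
    assume inv: "store_inv t s A" "\<not> s vZero < s vF" and \<tau>: "\<tau> \<le> n ^ h * (step_time + 1) + 1"
    have b: "base (n * n + 1) s" "s vRes = 0" "A aGA = (\<lambda>_. 0)" "sound (A aDic)"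
      using inv by (auto simp: store_inv_def)
    have "t = n ^ h" using inv b by (auto simp: store_inv_def base_def env_def)
    then have st: "stored (A aDic) y" if "tuple y" for y
      using inv that val_less[of y n] by (auto simp: store_inv_def tuple_def)
    have "wp x M (prepare_prog ;; WhileLess vZero vF lookup_step) (\<lambda>\<tau> s A.
      \<tau> \<le> (1 + (1 + (1 + (complete_time + 2)))) + (n ^ h * (lookup_time + 1) + 1) \<and>
      s vRes = (if G \<cong> H then 1 else 0)) s A"
    proof (rule wp_seq, rule wp_mono[OF wp_prepare[where A = A, OF b(1-3)]], elim conjE exE, rule conjI, assumption)
      fix \<tau> s' A' a
      assume a: "tuple a" "greedy G 1 a" and li: "lookup_inv (A aDic) a 0 s' A'"
      note iff = iso_iff_collision[OF b(4) st a]
      show "wp x M (WhileLess vZero vF lookup_step) (\<lambda>\<tau> s A. \<tau> \<le> n ^ h * (lookup_time + 1) + 1 \<and>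
        s vRes = (if G \<cong> H then 1 else 0)) s' A'"
      proof (rule wp_while[where Inv = "lookup_inv (A aDic) a", OF li])
        show "t < n ^ h \<and> wp x M lookup_step (\<lambda>\<tau> s A'. \<tau> \<le> lookup_time \<and> lookup_inv (A aDic) a (Suc t) s A') s A'"
          if "lookup_inv (A aDic) a t s A'" "s vZero < s vF" for t s A' by (rule wp_lookup_step[OF that])
        fix t s A' \<tau>
        assume inv: "lookup_inv (A aDic) a t s A'" "\<not> s vZero < s vF" and \<tau>: "\<tau> \<le> n ^ h * (lookup_time + 1) + 1"
        have "t = n ^ h" using inv by (auto simp: lookup_inv_def base_def env_def)
        then have *: "s vRes = 1" if "tuple y" "stops (mult G) (a @ y) t'"
            "A aDic (code n (mult G) (a @ y) t') \<noteq> 0" for y t'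
          using inv that val_less[of y n] unfolding lookup_inv_def tuple_def by auto
        have "s vRes = 1 \<longleftrightarrow> G \<cong> H"
          using iff * inv(1) unfolding lookup_inv_def by metis
        moreover have "s vRes \<le> 1" using inv(1) by (simp add: lookup_inv_def)
        ultimately show "\<tau> \<le> n ^ h * (lookup_time + 1) + 1 \<and> s vRes = (if G \<cong> H then 1 else 0)"
          using \<tau> by auto
      qed
    qed
    with \<tau> show "\<tau> \<le> n ^ h * (step_time + 1) + 1 \<and>
      wp x M (prepare_prog ;; WhileLess vZero vF lookup_step) (\<lambda>\<tau> s A.
      \<tau> \<le> (1 + (1 + (1 + (complete_time + 2)))) + (n ^ h * (lookup_time + 1) + 1) \<and>
      s vRes = (if G \<cong> H then 1 else 0)) s A" by simp
  qed
qed

end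

section \<open>Running time\<close>

text \<open>A crude linear bound suffices for the polynomial factors; it comes from
  \<open>2 * h - 3 < 2 ^ (2 * h - 3)\<close>.\<close>

lemma two_h_le:
  assumes "0 < n" "h = 1 \<or> 2 ^ (2 * h - 3) < n"
  shows "2 * h \<le> 3 * n"
proof (cases "h = 1")
  case False
  then have "2 * h - 3 < n" using assms(2) less_exp[of "2 * h - 3"] by linarith
  then show ?thesis using assms(1) by simp
qed (use assms(1) in simp)

context iso_algorithm
begin

text \<open>A search is cubic and a completion, with up to \<open>2 * h\<close> searches, quartic;
  the rest of a round is of lower order.\<close>

lemma total_time_le: "total_time \<le> 1000 * (n ^ h * n ^ 4)"
proof -
  note two_h_le = two_h_le[OF n_pos h_min]
  have p: "1 \<le> n" "n \<le> n ^ 3" "n ^ 3 \<le> n ^ 4" "1 \<le> n ^ 3" "1 \<le> n ^ 4" "1 \<le> n ^ h"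
    using n_pos power_increasing[of 1 3 n] power_increasing[of 3 4 n] by auto
  have "n * (2 * h) * (6 * n + 22) \<le> n * (3 * n) * (28 * n)"
    using p by (intro mult_le_mono[OF mult_le_mono2[OF two_h_le]]) simp
  also have "\<dots> = 84 * n ^ 3" by (simp add: power3_eq_cube)
  finally have b: "bfs_time \<le> 99 * n ^ 3" unfolding bfs_time_def using p by linarith
  have "2 * h * (bfs_time + 5 * n + 6) \<le> 3 * n * (110 * n ^ 3)"
    using b p by (intro mult_le_mono[OF two_h_le]) linarith
  also have "\<dots> = 330 * n ^ 4" by (simp add: power_numeral_reduce)
  finally have c: "complete_time \<le> 331 * n ^ 4" unfolding complete_time_def using p by linarith
  have s: "step_time + 1 \<le> 470 * n ^ 4" unfolding step_time_def using b c p two_h_le by linarith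
  have l: "lookup_time + 1 \<le> 140 * n ^ 4" unfolding lookup_time_def using b p two_h_le by linarith
  have 1: "n ^ h * (step_time + 1) \<le> 470 * (n ^ h * n ^ 4)"
    using mult_le_mono2[OF s, of "n ^ h"] by simp
  have 2: "n ^ h * (lookup_time + 1) \<le> 140 * (n ^ h * n ^ 4)"
    using mult_le_mono2[OF l, of "n ^ h"] by simp
  have 3: "n ^ 4 \<le> n ^ h * n ^ 4" using p(6) by simp
  show ?thesis unfolding total_time_def using 1 2 3 c p two_h_le by linarith
qed

end

section \<open>Layout of the input\<close>

lemma length_concat_rows: "length (concat (map (\<lambda>i. map (f i) [0..<n]) [0..<k])) = k * n"
  by (induction k) simp_all

lemma nth_concat_rows:
  "u < k \<Longrightarrow> w < n \<Longrightarrow> concat (map (\<lambda>i. map (f i) [0..<n]) [0..<k]) ! (n * u + w) = f u w"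
proof (induction k)
  case (Suc k)
  show ?case
  proof (cases "u < k")
    case True
    then have "n * u + w < n * Suc u" "n * Suc u \<le> n * k"
      using Suc.prems by (simp, intro mult_le_mono2) simp
    then have "n * u + w < k * n" by (simp add: mult.commute)
    with True Suc show ?thesis by (simp add: nth_append length_concat_rows)
  next
    case False
    then have "u = k" using Suc.prems by simp
    then show ?thesis using Suc.prems by (simp add: nth_append length_concat_rows mult.commute)
  qed
qed simp

lemma input_iso_instance:
  assumes "u < n" "w < n"
  shows "input_at (iso_instance n G H) (w + 1 + n * u) = u \<otimes>\<^bsub>G\<^esub> w"
    and "input_at (iso_instance n G H) (w + (n * n + 1) + n * u) = u \<otimes>\<^bsub>H\<^esub> w"
proof -
  have "n * u + w < n * Suc u" "n * Suc u \<le> n * n"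
    using assms by (simp, intro mult_le_mono2) simp
  then have lt: "n * u + w < n * n" by simp
  have len: "length (mult_table n K) = n * n" for K
    by (simp add: mult_table_def length_concat_rows)
  have nth: "mult_table n K ! (n * u + w) = u \<otimes>\<^bsub>K\<^esub> w" for K
    unfolding mult_table_def using nth_concat_rows[OF assms] .
  have "w + 1 + n * u = Suc (n * u + w)" "w + (n * n + 1) + n * u = Suc (n * n + (n * u + w))" by auto
  then show "input_at (iso_instance n G H) (w + 1 + n * u) = u \<otimes>\<^bsub>G\<^esub> w"
    "input_at (iso_instance n G H) (w + (n * n + 1) + n * u) = u \<otimes>\<^bsub>H\<^esub> w"
    using lt by (simp_all only: input_at_def iso_instance_def)
      (simp_all add: len nth nth_append)
qed

lemma input_iso_instance_less:
  assumes "group G" "carrier G = {0..<n}" "group H" "carrier H = {0..<n}" "n < c"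
  shows "input_at (iso_instance n G H) i < c"
proof -
  have t: "set (mult_table n K) \<subseteq> {0..<n}" if "group K" "carrier K = {0..<n}" for K
    using that monoid.m_closed[OF group.is_monoid[OF that(1)]] by (auto simp: mult_table_def)
  have "set (iso_instance n G H) \<subseteq> {..n}"
    using t[OF assms(1,2)] t[OF assms(3,4)] by (auto simp: iso_instance_def)
  then have "input_at (iso_instance n G H) i \<le> n"
    by (simp add: input_at_def) (meson atMost_iff nth_mem subsetD)
  then show ?thesis using assms(5) by simp
qed

text \<open>The least \<open>h\<close> works: if it is not 1, its predecessor fails, and
  \<open>2 * (h - 1) - 1 = 2 * h - 3\<close>.\<close>

lemma exists_half_generator_count:
  "\<exists>h. 0 < h \<and> n \<le> 2 ^ (2 * h - 1) \<and> (h = 1 \<or> 2 ^ (2 * h - 3) < (n::nat))"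
proof -
  let ?P = "\<lambda>h. 0 < h \<and> n \<le> 2 ^ (2 * h - 1)"
  have "(2::nat) ^ n \<le> 2 ^ (2 * Suc n - 1)" by (intro power_increasing) auto
  then have "n \<le> 2 ^ (2 * Suc n - 1)" using less_exp[of n] by linarith
  then have ex: "?P (Suc n)" by simp
  define h where "h = Least ?P"
  have h: "?P h" unfolding h_def using ex by (rule LeastI)
  have "h = 1 \<or> 2 ^ (2 * h - 3) < n"
  proof (cases "h = 1")
    case False
    then have "h - 1 < h" using h by simp
    then have "\<not> ?P (h - 1)" unfolding h_def by (rule not_less_Least)
    moreover have "2 * (h - 1) - 1 = 2 * h - 3" by simp
    ultimately show ?thesis using h False by auto
  qed simp
  with h show ?thesis by blast
qed

lemma iso_prog_correct:
  assumes G: "group G" "carrier G = {0..<n}" and H: "group H" "carrier H = {0..<n}"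
  shows "\<exists>t h. computes_in_time (compile 0 iso_prog) (iso_instance n G H) (if G \<cong> H then 1 else 0) t \<and>
    t \<le> 500000 * n ^ (h + 7) \<and> (h = 1 \<or> 2 ^ (2 * h - 3) < n)"
proof -
  have n: "0 < n" using monoid.one_closed[OF group.is_monoid[OF G(1)]] G(2) by auto
  obtain h where h: "0 < h" "n \<le> 2 ^ (2 * h - 1)" "h = 1 \<or> 2 ^ (2 * h - 3) < n"
    using exists_half_generator_count by blast
  note h2 = two_h_le[OF n h(3)]
  \<comment> \<open>The first summand accounts for the length of a code; \<open>4 * n + 12\<close>
    makes \<open>2 ^ b\<close> at least \<open>4096 * 2 ^ (4 * n)\<close>, ample for the polynomial
    in \<open>M_large\<close>.\<close>
  define b where "b = n * (n * (2 * h)) + 4 * n + 12"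
  have nn: "n < 2 ^ n" by (rule less_exp)
  have "n * n \<le> 2 ^ n * 2 ^ n" using nn by (intro mult_le_mono) auto
  also have "\<dots> = 2 ^ (2 * n)" by (simp add: mult_2 power_add)
  also have "\<dots> \<le> 2 ^ (4 * n)" by (intro power_increasing) auto
  finally have n4: "n * n \<le> 2 ^ (4 * n)" .
  have big: "4096 * 2 ^ (4 * n) \<le> (2::nat) ^ b"
  proof -
    have "4096 * 2 ^ (4 * n) = (2::nat) ^ (4 * n + 12)" by (simp add: power_add)
    also have "\<dots> \<le> 2 ^ b" by (intro power_increasing) (auto simp: b_def)
    finally show ?thesis .
  qed
  have n1: "1 \<le> n * n" "n \<le> n * n" using n by (simp_all add: Suc_le_eq)
  have n2: "n < 2 ^ b" using n1 n4 big n by linarith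
  interpret bounds "iso_instance n G H" "2 ^ b" n "2 * h"
  proof
    show "0 < n" by fact
    show "2 ^ (n * (n * (2 * h)) + 1) \<le> (2::nat) ^ b" by (intro power_increasing) (auto simp: b_def)
    show "4 * n * n + 4 * n + 2 * (2 * h) + 10 < 2 ^ b"
      using n1 n4 big h2 unfolding mult.assoc by linarith
  qed
  interpret iso_algorithm "iso_instance n G H" "2 ^ b" n h G H
  proof (intro iso_algorithm.intro iso_algorithm_axioms.intro)
    show "bounds (2 ^ b) n (2 * h)" by (rule bounds_axioms)
    show "group G" "carrier G = {0..<n}" "group H" "carrier H = {0..<n}" by fact+
    show "0 < h" "n \<le> 2 ^ (2 * h - 1)" "h = 1 \<or> 2 ^ (2 * h - 3) < n" by fact+
    show "input_at (iso_instance n G H) 0 = n" by (simp add: input_at_def iso_instance_def)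
    show "table 1 (mult G)" "table (n * n + 1) (mult H)"
      unfolding table_def using input_iso_instance[of _ n _ G H]
        monoid.m_closed[OF group.is_monoid[OF G(1)]] monoid.m_closed[OF group.is_monoid[OF H(1)]] G(2) H(2)
      by simp_all
  qed
  have "b \<ge> 1" by (simp add: b_def)
  from wp_computes_in_time[OF wp_iso_prog this input_iso_instance_less[OF G H n2]]
  obtain t where t: "t \<le> total_time * (6 * unit_cost b)"
    "computes_in_time (compile 0 iso_prog) (iso_instance n G H) (if G \<cong> H then 1 else 0) t" by blast
  \<comment> \<open>The price of a command is linear in \<open>b\<close>, hence cubic in
    \<open>n\<close>; this raises the exponent from \<open>h + 4\<close> to
    \<open>h + 7\<close>.\<close>
  have p3: "n \<le> n ^ 3" "1 \<le> n ^ 3" using n power_increasing[of 1 3 n] by auto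
  have "n * (n * (2 * h)) \<le> n * (n * (3 * n))" using h2 by (intro mult_le_mono2)
  also have "\<dots> = 3 * n ^ 3" by (simp add: power3_eq_cube)
  finally have "b \<le> 19 * n ^ 3" unfolding b_def using p3 by linarith
  then have "12 * b + 240 \<le> 500 * n ^ 3" using p3(2) by linarith
  then have "6 * unit_cost b \<le> 500 * n ^ 3" by (simp add: unit_cost_def)
  with t(1) have "t \<le> (1000 * (n ^ h * n ^ 4)) * (500 * n ^ 3)"
    using mult_le_mono[OF total_time_le] by (meson order_trans)
  also have "\<dots> = 500000 * n ^ (h + 7)" by (simp add: power_add power_numeral_reduce)
  finally show ?thesis using t(2) h(3) by blast
qed

text \<open>Since \<open>n\<close> is at least 2, the constant factor moves into the exponent:
  \<open>500000 \<le> 2 ^ 19 \<le> n ^ 19\<close>. With \<open>h\<close> at most half the logarithm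
  plus 3/2, the additive part of the exponent is 7 + 19 + 3/2, rounded up to 28.\<close>

lemma time_bound:
  assumes "2 \<le> n" "t \<le> 500000 * n ^ (h + 7)" "h = 1 \<or> 2 ^ (2 * h - 3) < n"
  shows "real t \<le> real n powr (1 / 2 * log 2 (real n) + 28)"
proof -
  have n: "2 \<le> real n" using assms(1) by simp
  have h: "real h \<le> 1 / 2 * log 2 (real n) + 3 / 2"
  proof (cases "h = 1")
    case True
    have "1 \<le> log 2 (real n)" using n by (simp add: le_log_iff)
    then show ?thesis using True by simp
  next
    case False
    then have "2 ^ (2 * h - 3) < n" using assms(3) by blast
    then have "real (2 ^ (2 * h - 3)) < real n" by (simp only: of_nat_less_iff)
    then have "2 powr real (2 * h - 3) < real n" by (simp add: powr_realpow)
    then have "real (2 * h - 3) < log 2 (real n)" using n by (simp add: less_log_iff)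
    \<comment> \<open>Truncation of the natural subtraction can only enlarge the left-hand
      side.\<close>
    moreover have "real (2 * h - 3) \<ge> 2 * real h - 3" by linarith
    ultimately show ?thesis by simp
  qed
  have "(500000::real) \<le> 2 ^ 19" by simp
  also have "\<dots> \<le> real n ^ 19" using n by (intro power_mono) auto
  finally have c: "500000 \<le> real n ^ 19" .
  have "real t \<le> real (500000 * n ^ (h + 7))" using assms(2) by (simp only: of_nat_le_iff)
  also have "\<dots> = 500000 * real n ^ (h + 7)" by simp
  also have "\<dots> \<le> real n ^ 19 * real n ^ (h + 7)" using c by (intro mult_right_mono) auto
  also have "\<dots> = real n ^ (h + 26)" by (simp flip: power_add add: add.commute)
  also have "\<dots> = real n powr real (h + 26)" using n by (subst powr_realpow) simp_all
  also have "\<dots> \<le> real n powr (1 / 2 * log 2 (real n) + 28)" using n h by (intro powr_mono) auto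
  finally show ?thesis .
qed

text \<open>For \<open>n = 1\<close> the power is 1 whatever \<open>e\<close> is, so no constant can
  be absorbed there; hence the guard \<open>n \<ge> 2\<close> on the time bound.\<close>

theorem theorem3:
  "\<exists>(P :: program) (e :: nat \<Rightarrow> real).
     e \<in> O(\<lambda>_. 1) \<and>
     (\<forall>(p :: nat) (n :: nat) (G :: nat monoid) (H :: nat monoid).
        p_group p G \<and> p_group p H \<and> carrier G = {0..<n} \<and> carrier H = {0..<n} \<longrightarrow>
        (\<exists>t. computes_in_time P (iso_instance n G H) (if G \<cong> H then 1 else 0) t \<and>
             (n \<ge> 2 \<longrightarrow> real t \<le> real n powr ((1/2) * log 2 (real n) + e n))))"
proof (intro exI[of _ "compile 0 iso_prog"] exI[of _ "\<lambda>_. 28"] conjI allI impI)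
  show "(\<lambda>_. 28) \<in> O(\<lambda>_::nat. 1::real)" by simp
  fix p n :: nat and G H :: "nat monoid"
  assume "p_group p G \<and> p_group p H \<and> carrier G = {0..<n} \<and> carrier H = {0..<n}"
  then have "group G" "carrier G = {0..<n}" "group H" "carrier H = {0..<n}"
    by (auto simp: p_group_def)
  from iso_prog_correct[OF this] obtain t h where
    t: "computes_in_time (compile 0 iso_prog) (iso_instance n G H) (if G \<cong> H then 1 else 0) t"
      "t \<le> 500000 * n ^ (h + 7)" "h = 1 \<or> 2 ^ (2 * h - 3) < n" by blast
  show "\<exists>t. computes_in_time (compile 0 iso_prog) (iso_instance n G H) (if G \<cong> H then 1 else 0) t \<and>
    (n \<ge> 2 \<longrightarrow> real t \<le> real n powr ((1/2) * log 2 (real n) + 28))"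
    using t(1) time_bound[OF _ t(2,3)] by blast
qed

end
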